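(* Let $S$ be a finite right restriction EI-Ehresmann semigroup with set of projections $E$. Let $J$ be a regular $\mathcal J$-class of $S$ and choose a projection $e\in J$ (such a projection exists). Let $\Bbbk$ be an algebraically closed field in which the order of every subgroup of $S$ is invertible, and let $V$ be a simple $\Bbbk G_J$-module, where $G_J$ is the maximal subgroup associated with $J$. Then the dimension of $$\Bbbk\widetilde{\mathcal L}_E(e)\bigotimes_{\Bbbk G_J}V$$ as a $\Bbbk$-vector space is the multiplicity of $D(V)$ in the decomposition of $\Bbbk\widetilde{\mathcal L}_E(e)$ as a right $\Bbbk G_J$-module into simple modules.
   Context: A subsemilattice $E$ of a semigroup $S$ is a commutative subsemigroup of idempotents. Define equivalences on $S$: $a\,\widetilde{\mathcal L}_E\, b$ iff for all $e\in E$ ($ae=a\Leftrightarrow be=b$); $a\,\widetilde{\mathcal R}_E\, b$ iff for all $e\in E$ ($ea=a\Leftrightarrow eb=b$); $\widetilde{\mathcal H}_E=\widetilde{\mathcal L}_E\cap\widetilde{\mathcal R}_E$. $S$ is ($E$-)Ehresmann if every $\widetilde{\mathcal L}_E$-class and every $\widetilde{\mathcal R}_E$-class contains a unique element of $E$ (denoted $a^{*}$, resp. $a^{+}$, for the class of $a$), $\widetilde{\mathcal L}_E$ is a right congruence and $\widetilde{\mathcal R}_E$ is a left congruence; $E$ is then the set of projections. It is right restriction if $ea=a(ea)^{*}$ for all $a\in S$, $e\in E$. The category $\mathbf C(S)$ has object set $E$ and one morphism $C(a)$ for each $a\in S$, with domain $a^{*}$ and range $a^{+}$, and $C(b)C(a)=C(ba)$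 when defined. $S$ is EI-Ehresmann if every endomorphism in $\mathbf C(S)$ is an isomorphism; equivalently, the $\widetilde{\mathcal H}_E$-class of every $e\in E$ is a group. A $\mathcal J$-class is regular if it contains a regular element. $G_J$ is the maximal subgroup of $J$, identified with the $\mathcal H$-class $G_e$ of $e$. $\widetilde{\mathcal L}_E(e)$ is the $\widetilde{\mathcal L}_E$-class of $e$, and $\Bbbk\widetilde{\mathcal L}_E(e)$ is the $\Bbbk$-vector space with this basis; it is a right $\Bbbk G_e$-module via right multiplication. For a left $\Bbbk G$-module $V$, $D(V)=\operatorname{Hom}_{\Bbbk}(V,\Bbbk)$ is its dual, a right $\Bbbk G$-module. *)

theory Defs
  imports "HOL-Algebra.AbelCoset" "Jordan_Normal_Form.VS_Connect"
begin

section \<open>Ehresmann semigroups\<close>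

text \<open>The semigroup is the universe of a type of class \<open>semigroup_mult\<close>.\<close>

definition subsemilattice :: "'a::semigroup_mult set \<Rightarrow> bool" where
  "subsemilattice E \<longleftrightarrow>
     (\<forall>e\<in>E. \<forall>f\<in>E. e * f \<in> E \<and> e * f = f * e) \<and> (\<forall>e\<in>E. e * e = e)"

definition tilde_L :: "'a::semigroup_mult set \<Rightarrow> 'a \<Rightarrow> 'a \<Rightarrow> bool" where
  "tilde_L E a b \<longleftrightarrow> (\<forall>e\<in>E. a * e = a \<longleftrightarrow> b * e = b)"

definition tilde_R :: "'a::semigroup_mult set \<Rightarrow> 'a \<Rightarrow> 'a \<Rightarrow> bool" where
  "tilde_R E a b \<longleftrightarrow> (\<forall>e\<in>E. e * a = a \<longleftrightarrow> e * b = b)"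

definition ehresmann :: "'a::semigroup_mult set \<Rightarrow> bool" where
  "ehresmann E \<longleftrightarrow> subsemilattice E \<and>
     (\<forall>a. \<exists>!e. e \<in> E \<and> tilde_L E a e) \<and>
     (\<forall>a. \<exists>!e. e \<in> E \<and> tilde_R E a e) \<and>
     (\<forall>a b c. tilde_L E a b \<longrightarrow> tilde_L E (a * c) (b * c)) \<and>
     (\<forall>a b c. tilde_R E a b \<longrightarrow> tilde_R E (c * a) (c * b))"

definition proj_star :: "'a::semigroup_mult set \<Rightarrow> 'a \<Rightarrow> 'a" where
  "proj_star E a = (THE e. e \<in> E \<and> tilde_L E a e)"

definition proj_plus :: "'a::semigroup_mult set \<Rightarrow> 'a \<Rightarrow> 'a" where
  "proj_plus E a = (THE e. e \<in> E \<and> tilde_R E a e)"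

definition right_restriction :: "'a::semigroup_mult set \<Rightarrow> bool" where
  "right_restriction E \<longleftrightarrow> (\<forall>a. \<forall>e\<in>E. e * a = a * proj_star E (e * a))"

text \<open>In the category \<open>C(S)\<close> the morphism \<open>C(a)\<close>, represented by \<open>a\<close> itself, goes from
  \<open>proj_star E a\<close> to \<open>proj_plus E a\<close>, and \<open>C(b) C(a) = C(b * a)\<close> is defined when the domain of
  \<open>C(b)\<close> is the range of \<open>C(a)\<close>. The identity morphism of an object \<open>f\<close> is \<open>C(f)\<close>.\<close>

definition cat_composable :: "'a::semigroup_mult set \<Rightarrow> 'a \<Rightarrow> 'a \<Rightarrow> bool" where
  "cat_composable E b a \<longleftrightarrow> proj_star E b = proj_plus E a"

definition cat_iso :: "'a::semigroup_mult set \<Rightarrow> 'a \<Rightarrow> bool" where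
  "cat_iso E a \<longleftrightarrow> (\<exists>b. cat_composable E b a \<and> cat_composable E a b \<and>
     b * a = proj_star E a \<and> a * b = proj_plus E a)"

definition EI_ehresmann :: "'a::semigroup_mult set \<Rightarrow> bool" where
  "EI_ehresmann E \<longleftrightarrow>
     ehresmann E \<and> (\<forall>a. proj_star E a = proj_plus E a \<longrightarrow> cat_iso E a)"


section \<open>Green's relations and subgroups\<close>

definition left_ideal :: "'a::semigroup_mult \<Rightarrow> 'a set" where
  "left_ideal a = insert a {s * a | s. True}"

definition right_ideal :: "'a::semigroup_mult \<Rightarrow> 'a set" where
  "right_ideal a = insert a {a * t | t. True}"

definition two_sided_ideal :: "'a::semigroup_mult \<Rightarrow> 'a set" where
  "two_sided_ideal a =
     insert a ({s * a | s. True} \<union> {a * t | t. True} \<union> {s * a * t | s t. True})"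

definition green_H_class :: "'a::semigroup_mult \<Rightarrow> 'a set" where
  "green_H_class a = {b. left_ideal b = left_ideal a \<and> right_ideal b = right_ideal a}"

definition green_J :: "('a::semigroup_mult \<times> 'a) set" where
  "green_J = {(a, b). two_sided_ideal a = two_sided_ideal b}"

definition regular_element :: "'a::semigroup_mult \<Rightarrow> bool" where
  "regular_element a \<longleftrightarrow> (\<exists>x. a * x * a = a)"

definition is_subgroup :: "'a::semigroup_mult set \<Rightarrow> bool" where
  "is_subgroup H \<longleftrightarrow> (\<exists>u. group \<lparr>carrier = H, mult = (*), one = u\<rparr>)"


section \<open>Modules over a noncommutative ring\<close>

text \<open>The library locale \<^locale>\<open>module\<close> requires a commutative ring of scalars. Below,
  left and right modules share the record type of that locale; if \<open>M\<close> is a right module, then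
  \<open>r \<odot>\<^bsub>M\<^esub> m\<close> stands for \<open>m r\<close>, the product of \<open>m\<close> by \<open>r\<close> on the right.\<close>

locale left_module = R?: ring R + M?: abelian_group M
  for R :: "('r, 'p) ring_scheme" (structure) and M :: "('r, 'm, 'q) module_scheme" (structure) +
  assumes smult_closed:
      "\<lbrakk>a \<in> carrier R; x \<in> carrier M\<rbrakk> \<Longrightarrow> a \<odot>\<^bsub>M\<^esub> x \<in> carrier M"
    and smult_l_distr:
      "\<lbrakk>a \<in> carrier R; b \<in> carrier R; x \<in> carrier M\<rbrakk> \<Longrightarrow>
         (a \<oplus> b) \<odot>\<^bsub>M\<^esub> x = a \<odot>\<^bsub>M\<^esub> x \<oplus>\<^bsub>M\<^esub> b \<odot>\<^bsub>M\<^esub> x"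
    and smult_r_distr:
      "\<lbrakk>a \<in> carrier R; x \<in> carrier M; y \<in> carrier M\<rbrakk> \<Longrightarrow>
         a \<odot>\<^bsub>M\<^esub> (x \<oplus>\<^bsub>M\<^esub> y) = a \<odot>\<^bsub>M\<^esub> x \<oplus>\<^bsub>M\<^esub> a \<odot>\<^bsub>M\<^esub> y"
    and smult_assoc:
      "\<lbrakk>a \<in> carrier R; b \<in> carrier R; x \<in> carrier M\<rbrakk> \<Longrightarrow>
         (a \<otimes> b) \<odot>\<^bsub>M\<^esub> x = a \<odot>\<^bsub>M\<^esub> (b \<odot>\<^bsub>M\<^esub> x)"
    and smult_one:
      "x \<in> carrier M \<Longrightarrow> \<one> \<odot>\<^bsub>M\<^esub> x = x"

text \<open>The following notions are the same for left and for right modules. The predicate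
  \<open>Module.submodule\<close> of HOL-Algebra does not need commutativity of \<open>R\<close>.\<close>

definition simple_module :: "('r, 'p) ring_scheme \<Rightarrow> ('r, 'm, 'q) module_scheme \<Rightarrow> bool" where
  "simple_module R M \<longleftrightarrow> carrier M \<noteq> {\<zero>\<^bsub>M\<^esub>} \<and>
     (\<forall>W. Module.submodule W R M \<longrightarrow> W = {\<zero>\<^bsub>M\<^esub>} \<or> W = carrier M)"

definition module_isomorphic ::
  "('r, 'p) ring_scheme \<Rightarrow> ('r, 'm, 'q) module_scheme \<Rightarrow> ('r, 'n, 's) module_scheme \<Rightarrow> bool" where
  "module_isomorphic R M N \<longleftrightarrow>
     (\<exists>f\<in>LinearCombinations.module_hom R M N. bij_betw f (carrier M) (carrier N))"

text \<open>\<open>M\<close> is the internal direct sum of its simple submodules \<open>W 0, \<dots>, W (n - 1)\<close>.\<close>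

definition simple_decomposition ::
  "('r, 'p) ring_scheme \<Rightarrow> ('r, 'm, 'q) module_scheme \<Rightarrow> nat \<Rightarrow> (nat \<Rightarrow> 'm set) \<Rightarrow> bool" where
  "simple_decomposition R M n W \<longleftrightarrow>
     (\<forall>i<n. Module.submodule (W i) R M \<and> simple_module R (M\<lparr>carrier := W i\<rparr>)) \<and>
     (\<forall>x\<in>carrier M. \<exists>!w. w \<in> (\<Pi>\<^sub>E i\<in>{..<n}. W i) \<and> x = (\<Oplus>\<^bsub>M\<^esub>i\<in>{..<n}. w i))"

text \<open>To say that \<open>N\<close> has multiplicity \<open>d\<close> in \<open>M\<close> includes that \<open>M\<close> does decompose into
  simple modules and that the number of summands isomorphic to \<open>N\<close> does not depend on the
  decomposition.\<close>

definition has_multiplicity ::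
  "('r, 'p) ring_scheme \<Rightarrow> ('r, 'm, 'q) module_scheme \<Rightarrow> ('r, 'n, 's) module_scheme \<Rightarrow> nat \<Rightarrow> bool" where
  "has_multiplicity R M N d \<longleftrightarrow>
     (\<exists>n W. simple_decomposition R M n W) \<and>
     (\<forall>n W. simple_decomposition R M n W \<longrightarrow>
        card {i. i < n \<and> module_isomorphic R (M\<lparr>carrier := W i\<rparr>) N} = d)"


section \<open>Modules over an algebra over a field\<close>

text \<open>Here \<open>R\<close> is an algebra over the field \<open>'k\<close>, and \<open>\<iota> c\<close> is the scalar multiple of the
  identity of \<open>R\<close> by \<open>c\<close>. The field itself is \<open>class_ring\<close>. The fields \<open>mult\<close> and \<open>one\<close> of a
  module record carry no information.\<close>

definition restrict_scalars ::
  "('k \<Rightarrow> 'r) \<Rightarrow> ('r, 'm, 'q) module_scheme \<Rightarrow> ('k, 'm) module" where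
  "restrict_scalars \<iota> M =
     \<lparr>carrier = carrier M, mult = mult M, one = one M, zero = zero M, add = add M,
      smult = (\<lambda>c x. \<iota> c \<odot>\<^bsub>M\<^esub> x)\<rparr>"

definition field_module :: "('k::field, 'k) module" where
  "field_module = \<lparr>carrier = UNIV, mult = (*), one = 1, zero = 0, add = (+), smult = (*)\<rparr>"

text \<open>The dual of a left module, as a right module. Functions on the carrier of \<open>M\<close> are
  represented by extensional functions.\<close>

definition dual_module ::
  "('k::field \<Rightarrow> 'r) \<Rightarrow> ('r, 'm, 'q) module_scheme \<Rightarrow> ('r, 'm \<Rightarrow> 'k) module" where
  "dual_module \<iota> M =
     \<lparr>carrier = LinearCombinations.module_hom class_ring (restrict_scalars \<iota> M) field_module
                 \<inter> extensional (carrier M),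
      mult = undefined, one = undefined,
      zero = (\<lambda>x\<in>carrier M. 0),
      add = (\<lambda>\<phi> \<psi>. \<lambda>x\<in>carrier M. \<phi> x + \<psi> x),
      smult = (\<lambda>r \<phi>. \<lambda>x\<in>carrier M. \<phi> (r \<odot>\<^bsub>M\<^esub> x))\<rparr>"

definition free_space :: "'x set \<Rightarrow> ('k::field, 'x \<Rightarrow> 'k) module" where
  "free_space X =
     \<lparr>carrier = {f. finite {x. f x \<noteq> 0} \<and> {x. f x \<noteq> 0} \<subseteq> X},
      mult = undefined, one = undefined,
      zero = (\<lambda>x. 0),
      add = (\<lambda>f g x. f x + g x),
      smult = (\<lambda>c f x. c * f x)\<rparr>"

definition quotient_space ::
  "('k, 'm, 'q) module_scheme \<Rightarrow> 'm set \<Rightarrow> ('k, 'm set) module" where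
  "quotient_space M N =
     \<lparr>carrier = A_RCOSETS M N,
      mult = undefined, one = undefined,
      zero = N,
      add = set_add M,
      smult = (\<lambda>c X. set_add M N ((\<lambda>x. c \<odot>\<^bsub>M\<^esub> x) ` X))\<rparr>"

definition single :: "'x \<Rightarrow> 'k::zero \<Rightarrow> 'x \<Rightarrow> 'k" where
  "single x c = (\<lambda>y. if y = x then c else 0)"

text \<open>The tensor product over \<open>R\<close> of a right module \<open>M\<close> and a left module \<open>N\<close>, as a vector
  space: the free vector space on \<open>M \<times> N\<close> modulo the subspace spanned by the elements
  \<open>(x + x', y) - (x, y) - (x', y)\<close>, \<open>(x, y + y') - (x, y) - (x, y')\<close>, \<open>(x r, y) - (x, r y)\<close>
  and \<open>(x c, y) - c (x, y)\<close>, for ring elements \<open>r\<close> and scalars \<open>c\<close>.\<close>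

definition tensor_relations ::
  "('k::field \<Rightarrow> 'r) \<Rightarrow> ('r, 'p) ring_scheme \<Rightarrow> ('r, 'm, 'q) module_scheme \<Rightarrow>
   ('r, 'n, 's) module_scheme \<Rightarrow> ('m \<times> 'n \<Rightarrow> 'k) set" where
  "tensor_relations \<iota> R M N =
     {\<lambda>z. single (x \<oplus>\<^bsub>M\<^esub> x', y) 1 z - single (x, y) 1 z - single (x', y) 1 z | x x' y.
        x \<in> carrier M \<and> x' \<in> carrier M \<and> y \<in> carrier N} \<union>
     {\<lambda>z. single (x, y \<oplus>\<^bsub>N\<^esub> y') 1 z - single (x, y) 1 z - single (x, y') 1 z | x y y'.
        x \<in> carrier M \<and> y \<in> carrier N \<and> y' \<in> carrier N} \<union>
     {\<lambda>z. single (r \<odot>\<^bsub>M\<^esub> x, y) 1 z - single (x, r \<odot>\<^bsub>N\<^esub> y) 1 z | r x y.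
        r \<in> carrier R \<and> x \<in> carrier M \<and> y \<in> carrier N} \<union>
     {\<lambda>z. single (\<iota> c \<odot>\<^bsub>M\<^esub> x, y) 1 z - c * single (x, y) 1 z | c x y.
        x \<in> carrier M \<and> y \<in> carrier N}"

definition tensor_product ::
  "('k::field \<Rightarrow> 'r) \<Rightarrow> ('r, 'p) ring_scheme \<Rightarrow> ('r, 'm, 'q) module_scheme \<Rightarrow>
   ('r, 'n, 's) module_scheme \<Rightarrow> ('k, ('m \<times> 'n \<Rightarrow> 'k) set) module" where
  "tensor_product \<iota> R M N =
     (let F = free_space (carrier M \<times> carrier N)
      in quotient_space F
           (LinearCombinations.module.span class_ring F (tensor_relations \<iota> R M N)))"


section \<open>Group algebras inside the algebra of a finite semigroup\<close>

text \<open>An element of the semigroup algebra is a function giving the coefficient of each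
  semigroup element. For a subset \<open>X\<close> of the semigroup, the vector space with basis \<open>X\<close> is the
  set of coefficient functions vanishing outside \<open>X\<close>.\<close>

definition supported_on :: "'a set \<Rightarrow> ('a \<Rightarrow> 'k::zero) set" where
  "supported_on X = {f. \<forall>x. x \<notin> X \<longrightarrow> f x = 0}"

definition convolution ::
  "('a::{finite, semigroup_mult} \<Rightarrow> 'k::field) \<Rightarrow> ('a \<Rightarrow> 'k) \<Rightarrow> 'a \<Rightarrow> 'k" where
  "convolution f g = (\<lambda>x. \<Sum>(a, b) | a * b = x. f a * g b)"

text \<open>The group algebra of the maximal subgroup at an idempotent \<open>e\<close>. The embedding of the
  field into it is \<open>single e\<close>.\<close>

definition group_algebra :: "'a::{finite, semigroup_mult} \<Rightarrow> ('a \<Rightarrow> 'k::field) ring" where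
  "group_algebra e =
     \<lparr>carrier = supported_on (green_H_class e),
      mult = convolution,
      one = single e 1,
      zero = (\<lambda>x. 0),
      add = (\<lambda>f g x. f x + g x)\<rparr>"

text \<open>The vector space with basis the class of \<open>e\<close> under \<open>tilde_L E\<close>, with the group algebra
  at \<open>e\<close> acting by right multiplication.\<close>

definition tilde_L_module ::
  "'a::{finite, semigroup_mult} set \<Rightarrow> 'a \<Rightarrow> ('a \<Rightarrow> 'k::field, 'a \<Rightarrow> 'k) module" where
  "tilde_L_module E e =
     \<lparr>carrier = supported_on {a. tilde_L E a e},
      mult = undefined, one = undefined,
      zero = (\<lambda>x. 0),
      add = (\<lambda>f g x. f x + g x),
      smult = (\<lambda>r f. convolution f r)\<rparr>"

end

theory Submission
  imports Defs "HOL-Library.Function_Algebras"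
begin

text \<open>
  Let \<open>G\<close> be the maximal subgroup at \<open>e\<close> and \<open>M\<close> the right module spanned by the class of \<open>e\<close>.
  Functionals on \<open>M \<otimes> V\<close> are the same as balanced bilinear forms on \<open>M \<times> V\<close>. By Maschke's theorem
  \<open>M\<close> is a direct sum of simple submodules \<open>W\<close>, and a balanced form on \<open>M \<times> V\<close> is a family of
  balanced forms on the \<open>W \<times> V\<close>. As \<open>W\<close> and \<open>V\<close> are simple, a nonzero form on \<open>W \<times> V\<close> is
  nondegenerate, so it identifies \<open>W\<close> with the dual of \<open>V\<close>, and by Schur's lemma it is unique up to
  a scalar. Hence the dimension of \<open>M \<otimes> V\<close> is the number of the \<open>W\<close> isomorphic to the dual of \<open>V\<close>.

  A projection in a regular class is found as follows. If \<open>f\<close> is an idempotent of the class, then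
  right restriction gives \<open>f\<^sup>* f = f\<close>, so the projection \<open>p = f\<^sup>+\<close> satisfies \<open>p \<le> f\<^sup>*\<close> and \<open>f p\<close> is
  an endomorphism of \<open>p\<close>. It is invertible by the EI condition, whence \<open>p \<in> f S\<close>, while \<open>f = p f\<close>.
\<close>

section \<open>Linear algebra in spaces of functions\<close>

text \<open>The free space on \<open>M \<times> V\<close> behind the tensor product is
  infinite-dimensional, and \<open>V\<close> is an abstract module that comes without a basis, so no
  basis of the tensor product is at hand to be counted. Dual systems get around this: finitely many
  pure tensors t_i and functionals L_i, with L_i(t_j) equal to 1 for i = j and to 0 otherwise,
  determine the dimension as soon as the common kernel of the L_i is the space of relations. The
  dual of \<open>V\<close> is made concrete by a generator \<open>v0\<close>: a functional is
  recorded by its values on the translates \<open>g v0\<close>, which is a function on the group.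
  The dimension is computed from an arbitrary decomposition of \<open>M\<close> into simple
  submodules. Hence the number of summands isomorphic to the dual is the same for all
  decompositions, and Maschke's theorem has only to supply the existence of one. Schur's lemma rests
  on an eigenvector, which is where algebraic closedness of the field enters.\<close>

definition fscale :: "'k::field \<Rightarrow> ('x \<Rightarrow> 'k) \<Rightarrow> 'x \<Rightarrow> 'k" where
  "fscale c f = (\<lambda>x. c * f x)"

lemma fscale_apply [simp]: "fscale c f x = c * f x"
  by (simp add: fscale_def)

text \<open>Submodules of \<open>M\<close>, the free space and the recorded functionals are all sets
  of functions, so one vector space structure on function types serves them all; each of them then
  becomes an \<open>fs.subspace\<close>.\<close>

interpretation fs: vector_space fscale
  by unfold_locales (auto simp: fun_eq_iff algebra_simps)

interpretation fs_pair: vector_space_pair fscale fscale ..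

interpretation fs_dual: vector_space_pair fscale "(*)"
  by unfold_locales (auto simp: algebra_simps)

lemma sum_fun_apply [simp]: "(\<Sum>i\<in>I. f i) x = (\<Sum>i\<in>I. f i x :: 'b::comm_monoid_add)"
  by (induction I rule: infinite_finite_induct) auto

text \<open>A maximal independent subset of \<open>U\<close> stays independent when \<open>f\<close>
  is added, so a functional may be prescribed as 1 at \<open>f\<close> and 0 on that subset. This
  works in infinite dimension, as the free space requires.\<close>

lemma fs_separating_functional:
  fixes f :: "'x \<Rightarrow> 'k::field"
  assumes U: "fs.subspace U" and f: "f \<notin> U"
  obtains l where "Vector_Spaces.linear fscale (*) l" "\<And>u. u \<in> U \<Longrightarrow> l u = (0::'k)" "l f = 1"
proof -
  obtain B where B: "B \<subseteq> U" "fs.independent B" "U \<subseteq> fs.span B"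
    using fs.maximal_independent_subset[of U] by metis
  have span: "fs.span B = U"
    using B U by (meson fs.span_minimal subset_antisym)
  with f B have "fs.independent (insert f B)"
    by (simp add: fs.independent_insertI)
  then obtain l where l: "Vector_Spaces.linear fscale (*) l"
      "\<forall>x\<in>insert f B. l x = (if x = f then 1 else (0::'k))"
    using fs_dual.linear_independent_extend[of _ "\<lambda>x. if x = f then 1 else 0"] by metis
  have "l u = 0" if "u \<in> U" for u
  proof (rule fs_dual.linear_eq_0_on_span[OF l(1)])
    show "u \<in> fs.span B" using that span by simp
    show "\<And>b. b \<in> B \<Longrightarrow> l b = 0"
      using l(2) f B(1) by auto
  qed
  with l that show thesis by auto
qed

lemma single_apply: "single x c y = (if y = x then c else 0)"
  by (simp add: single_def)

lemma fun_eq_sum_single: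
  assumes "finite S" "{x. f x \<noteq> 0} \<subseteq> S"
  shows "f = (\<Sum>x\<in>S. fscale (f x) (single x (1::'k::field)))"
proof
  fix y
  have "(\<Sum>x\<in>S. fscale (f x) (single x 1)) y = (\<Sum>x\<in>S. if x = y then f x else 0)"
    by (auto simp: single_apply intro!: sum.cong)
  also have "\<dots> = f y"
    using assms by (auto simp: sum.delta)
  finally show "f y = (\<Sum>x\<in>S. fscale (f x) (single x 1)) y" by simp
qed

lemma linear_fun_eq_sum_single:
  fixes l :: "('x \<Rightarrow> 'k::field) \<Rightarrow> 'k"
  assumes l: "Vector_Spaces.linear fscale (*) l" and "finite S" "{x. f x \<noteq> 0} \<subseteq> S"
  shows "l f = (\<Sum>x\<in>S. f x * l (single x 1))"
proof -
  have "l f = l (\<Sum>x\<in>S. fscale (f x) (single x 1))"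
    by (rule arg_cong[OF fun_eq_sum_single[OF assms(2,3)]])
  also have "\<dots> = (\<Sum>x\<in>S. l (fscale (f x) (single x 1)))"
    by (rule fs_dual.linear_sum[OF l])
  also have "\<dots> = (\<Sum>x\<in>S. f x * l (single x 1))"
    by (simp add: fs_dual.linear_scale[OF l])
  finally show ?thesis .
qed

interpretation fin_fs: finite_dimensional_vector_space
  "fscale :: 'k::field \<Rightarrow> ('x::finite \<Rightarrow> 'k) \<Rightarrow> 'x \<Rightarrow> 'k" "range (\<lambda>x. single x 1)"
proof
  let ?s = "\<lambda>x::'x. single x (1::'k)"
  show "finite (range ?s)" by simp
  have inj: "inj ?s" by (auto simp: inj_def single_def fun_eq_iff split: if_splits)
  show "fs.independent (range ?s)"
  proof (rule fs.independent_if_scalars_zero)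
    show "finite (range ?s)" by simp
    fix c u assume 0: "(\<Sum>u\<in>range ?s. fscale (c u) u) = 0" and "u \<in> range ?s"
    then obtain y where y: "u = ?s y" by blast
    have "0 = (\<Sum>x\<in>UNIV. fscale (c (?s x)) (?s x)) y"
      using 0 inj by (simp add: sum.reindex o_def zero_fun_def fun_eq_iff)
    also have "\<dots> = (\<Sum>x\<in>UNIV. if x = y then c (?s x) else 0)"
      unfolding sum_fun_apply by (rule sum.cong) (auto simp: single_apply)
    finally show "c u = 0" using y by simp
  qed
  have "f \<in> fs.span (range ?s)" for f
    by (subst fun_eq_sum_single[of UNIV f])
      (auto intro!: fs.span_sum[OF fs.span_scale[OF fs.span_base]])
  then show "fs.span (range ?s) = UNIV" by auto
qed

text \<open>Dependence of the indexed family, not of its set of values: iterates of an endomorphism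
  may coincide, and a repetition \<open>x i = x j\<close> is itself a relation. The index range
  \<open>{..n}\<close> has \<open>n + 1\<close> elements, which exceeds the dimension.\<close>

lemma fs_linear_relation:
  fixes x :: "nat \<Rightarrow> 'a::finite \<Rightarrow> 'k::field"
  assumes n: "card (UNIV :: 'a set) \<le> n"
  obtains c where "(\<Sum>i\<le>n. fscale (c i) (x i)) = 0" "\<exists>i\<le>n. c i \<noteq> 0"
proof (cases "inj_on x {..n}")
  case True
  have "fs.dependent (x ` {..n})"
  proof (rule fin_fs.dependent_biggerset_general)
    have "fs.dim (x ` {..n}) \<le> card (UNIV :: 'a set)"
      using fin_fs.dim_subset_UNIV[of "x ` {..n}"] card_image_le[of "UNIV::'a set" "\<lambda>x. single x (1::'k)"]
      by (simp add: fin_fs.dimension_def)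
    also have "\<dots> < card (x ` {..n})" using n True by (simp add: card_image)
    finally show "fs.dim (x ` {..n}) < card (x ` {..n})" .
  qed
  then obtain u where u: "(\<Sum>v\<in>x ` {..n}. fscale (u v) v) = 0" "\<exists>v\<in>x ` {..n}. u v \<noteq> 0"
    by (auto simp: fs.dependent_finite)
  then show ?thesis
    using that[of "\<lambda>i. u (x i)"] True by (auto simp: sum.reindex o_def)
next
  case False
  then obtain i j where ij: "i \<le> n" "j \<le> n" "i \<noteq> j" "x i = x j" by (auto simp: inj_on_def)
  let ?c = "\<lambda>k. if k = i then 1 else if k = j then -1 else (0::'k)"
  have "(\<Sum>k\<le>n. fscale (?c k) (x k)) =
      (\<Sum>k\<le>n. (if k = i then x i else 0) + (if k = j then - x j else 0))"
    by (rule sum.cong) (use ij in \<open>auto simp: fun_eq_iff\<close>)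
  also have "\<dots> = 0"
    using ij by (simp add: sum.distrib)
  finally show ?thesis by (rule that) (intro exI[of _ i], use ij(1) in simp)
qed

subsection \<open>Eigenvectors\<close>

text \<open>Linearity is demanded on \<open>P\<close> only, because the endomorphism in Schur's
  lemma is obtained by choice on a simple submodule and is unspecified elsewhere.\<close>

locale fs_endomorphism =
  fixes P :: "('a::finite \<Rightarrow> 'k::alg_closed_field) set" and T
  assumes P: "fs.subspace P"
    and T_closed: "w \<in> P \<Longrightarrow> T w \<in> P"
    and T_add: "v \<in> P \<Longrightarrow> w \<in> P \<Longrightarrow> T (v + w) = T v + T w"
    and T_scale: "w \<in> P \<Longrightarrow> T (fscale c w) = fscale c (T w)"
begin

lemma pow_closed: "w \<in> P \<Longrightarrow> (T ^^ i) w \<in> P"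
  by (induction i) (auto simp: T_closed)

lemma pow_add: "v \<in> P \<Longrightarrow> w \<in> P \<Longrightarrow> (T ^^ i) (v + w) = (T ^^ i) v + (T ^^ i) w"
  by (induction i) (auto simp: T_add pow_closed)

lemma pow_scale: "w \<in> P \<Longrightarrow> (T ^^ i) (fscale c w) = fscale c ((T ^^ i) w)"
  by (induction i) (auto simp: T_scale pow_closed)

text \<open>The polynomial \<open>p\<close> in the operator \<open>T\<close>, applied to the vector
  \<open>w\<close>.\<close>

definition poly_at :: "'k poly \<Rightarrow> ('a \<Rightarrow> 'k) \<Rightarrow> 'a \<Rightarrow> 'k" where
  "poly_at p w = (\<Sum>i\<le>degree p. fscale (coeff p i) ((T ^^ i) w))"

lemma poly_at_eq:
  assumes "degree p \<le> n"
  shows "poly_at p w = (\<Sum>i\<le>n. fscale (coeff p i) ((T ^^ i) w))"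
  unfolding poly_at_def
  by (rule sum.mono_neutral_left) (use assms in \<open>auto simp: coeff_eq_0\<close>)

text \<open>In operator form: \<open>((X - c) q)(T) w = q(T) ((T - c) w)\<close>. The coefficients
  of the product are those of \<open>-c q\<close> plus those of \<open>q\<close> shifted by one, and
  the shift turns \<open>T ^^ Suc i\<close> at \<open>w\<close> into \<open>T ^^ i\<close> at
  \<open>T w\<close>.\<close>

lemma poly_at_linear_factor:
  assumes w: "w \<in> P"
  shows "poly_at ([:-c, 1:] * q) w = poly_at q (T w + fscale (-c) w)"
proof -
  let ?n = "degree q"
  have eq: "[:-c, 1:] * q = Polynomial.smult (-c) q + pCons 0 q" by simp
  have "degree ([:-c, 1:] * q) \<le> Suc ?n"
    unfolding eq by (intro degree_add_le) (auto intro: degree_smult_le[THEN order_trans])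
  then have "poly_at ([:-c, 1:] * q) w =
      (\<Sum>i\<le>Suc ?n. fscale (- c * coeff q i + coeff (pCons 0 q) i) ((T ^^ i) w))"
    by (subst poly_at_eq[of _ "Suc ?n"]) (simp_all only: eq coeff_add coeff_smult)
  also have "\<dots> = (\<Sum>i\<le>Suc ?n. fscale (- c * coeff q i) ((T ^^ i) w))
      + (\<Sum>i\<le>Suc ?n. fscale (coeff (pCons 0 q) i) ((T ^^ i) w))"
    by (simp only: fs.scale_left_distrib sum.distrib)
  also have "(\<Sum>i\<le>Suc ?n. fscale (- c * coeff q i) ((T ^^ i) w)) =
      (\<Sum>i\<le>?n. fscale (- c * coeff q i) ((T ^^ i) w))"
    by (simp add: coeff_eq_0)
  also have "(\<Sum>i\<le>Suc ?n. fscale (coeff (pCons 0 q) i) ((T ^^ i) w)) =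
      (\<Sum>i\<le>?n. fscale (coeff q i) ((T ^^ i) (T w)))"
  proof -
    have "(T ^^ Suc i) w = (T ^^ i) (T w)" for i
      by (simp only: funpow_Suc_right o_apply)
    then show ?thesis
      unfolding sum.atMost_Suc_shift coeff_pCons_0 coeff_pCons_Suc fs.scale_zero_left add_0
      by (simp only:)
  qed
  also have "(\<Sum>i\<le>?n. fscale (- c * coeff q i) ((T ^^ i) w)) + \<dots> =
      (\<Sum>i\<le>?n. fscale (coeff q i) ((T ^^ i) (T w + fscale (-c) w)))"
  proof -
    have "(T ^^ i) (T w + fscale (-c) w) = (T ^^ i) (T w) + fscale (-c) ((T ^^ i) w)" for i
      by (simp only: pow_add[OF T_closed[OF w] fs.subspace_scale[OF P w]] pow_scale[OF w])
    then show ?thesis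
      unfolding sum.distrib[symmetric]
      by (simp only: fs.scale_right_distrib fs.scale_scale mult.commute add.commute)
  qed
  finally show ?thesis unfolding poly_at_def[of q] .
qed

text \<open>Split off a root \<open>c\<close> of \<open>p\<close>. Either \<open>w\<close> is
  already an eigenvector for \<open>c\<close>, or \<open>(T - c) w\<close> is a nonzero vector
  annihilated by the cofactor, whose degree is one less. A nonzero constant annihilates no nonzero
  vector, which settles degree 0.\<close>

lemma eigenvector_if_annihilated:
  assumes "p \<noteq> 0" "w \<in> P" "w \<noteq> 0" "poly_at p w = 0"
  shows "\<exists>c. \<exists>u\<in>P. u \<noteq> 0 \<and> T u = fscale c u"
  using assms
proof (induction "degree p" arbitrary: p w)
  case 0
  then have "coeff p 0 \<noteq> 0"
    using leading_coeff_0_iff by metis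
  moreover have "fscale (coeff p 0) w = poly_at p w"
    unfolding poly_at_def 0(1)[symmetric] by simp
  ultimately show ?case using 0 by (metis fs.scale_eq_0_iff)
next
  case (Suc n)
  then obtain c where "poly p c = 0"
    using alg_closed_imp_poly_has_root[of p] by auto
  then obtain q where q: "p = [:-c, 1:] * q"
    by (metis dvd_def poly_eq_0_iff_dvd)
  with Suc have q0: "q \<noteq> 0" by auto
  then have deg: "n = degree q"
    using Suc.hyps(2) unfolding q by (subst (asm) degree_mult_eq) auto
  let ?u = "T w + fscale (-c) w"
  have u: "?u \<in> P"
    using Suc.prems(2) by (intro fs.subspace_add[OF P] T_closed fs.subspace_scale[OF P])
  show ?case
  proof (cases "?u = 0")
    case True
    then have "T w = fscale c w" by (auto simp: fun_eq_iff add_eq_0_iff)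
    with Suc.prems show ?thesis by auto
  next
    case False
    with Suc.hyps(1)[OF deg q0 u] Suc.prems(2,4) show ?thesis
      by (simp only: q poly_at_linear_factor simp_thms)
  qed
qed

text \<open>The iterates of a nonzero \<open>w\<close> up to exponent \<open>card UNIV\<close> are
  one too many to be independent; a linear relation between them is a nonzero polynomial
  annihilating \<open>w\<close>.\<close>

lemma eigenvector_exists:
  assumes "P \<noteq> {0}"
  shows "\<exists>c. \<exists>u\<in>P. u \<noteq> 0 \<and> T u = fscale c u"
proof -
  obtain w where w: "w \<in> P" "w \<noteq> 0"
    using assms P fs.subspace_0 by blast
  obtain c where c: "(\<Sum>i\<le>card (UNIV :: 'a set). fscale (c i) ((T ^^ i) w)) = 0" "\<exists>i\<le>card (UNIV :: 'a set). c i \<noteq> 0"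
    by (rule fs_linear_relation[OF order_refl])
  define p where "p = (\<Sum>i\<le>card (UNIV :: 'a set). monom (c i) i)"
  have coeff: "coeff p i = (if i \<le> card (UNIV :: 'a set) then c i else 0)" for i
    by (auto simp: p_def coeff_sum)
  have "p \<noteq> 0"
  proof
    assume "p = 0"
    moreover obtain i where "i \<le> card (UNIV :: 'a set)" "c i \<noteq> 0" using c(2) by blast
    ultimately show False using coeff[of i] by simp
  qed
  moreover have "degree p \<le> card (UNIV :: 'a set)" by (rule degree_le) (simp add: coeff)
  then have "poly_at p w = (\<Sum>i\<le>card (UNIV :: 'a set). fscale (c i) ((T ^^ i) w))"
    by (subst poly_at_eq) (auto simp: coeff intro!: sum.cong)
  ultimately show ?thesis
    using w by (intro eigenvector_if_annihilated[of p w]) (simp_all only: c(1) not_False_eq_True)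
qed

end

text \<open>As default rewrite rules these would turn equations between functions into equations between
  abstractions, on which the rules of \<open>vector_space\<close> no longer match.\<close>

lemmas fun_apply = fscale_apply plus_fun_apply zero_fun_apply sum_fun_apply
declare fun_apply [simp del]

section \<open>Projections in regular J-classes\<close>

lemma tilde_L_sym: "tilde_L E a b \<Longrightarrow> tilde_L E b a"
  and tilde_L_trans: "tilde_L E a b \<Longrightarrow> tilde_L E b c \<Longrightarrow> tilde_L E a c"
  and tilde_R_sym: "tilde_R E a b \<Longrightarrow> tilde_R E b a"
  and tilde_R_trans: "tilde_R E a b \<Longrightarrow> tilde_R E b c \<Longrightarrow> tilde_R E a c"
  by (auto simp: tilde_L_def tilde_R_def)

lemma two_sided_ideal_subset:
  assumes "x \<in> two_sided_ideal y"
  shows "two_sided_ideal x \<subseteq> two_sided_ideal y"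
  using assms unfolding two_sided_ideal_def by (auto simp flip: mult.assoc) (metis mult.assoc)+

context
  fixes E :: "'a::semigroup_mult set"
  assumes ehr: "ehresmann E"
begin

lemma proj_star_mem: "proj_star E a \<in> E" and tilde_L_proj_star: "tilde_L E a (proj_star E a)"
proof -
  have "\<exists>!e. e \<in> E \<and> tilde_L E a e" using ehr by (simp add: ehresmann_def)
  from theI'[OF this] show "proj_star E a \<in> E" "tilde_L E a (proj_star E a)"
    by (simp_all add: proj_star_def)
qed

lemma proj_plus_mem: "proj_plus E a \<in> E" and tilde_R_proj_plus: "tilde_R E a (proj_plus E a)"
proof -
  have "\<exists>!e. e \<in> E \<and> tilde_R E a e" using ehr by (simp add: ehresmann_def)
  from theI'[OF this] show "proj_plus E a \<in> E" "tilde_R E a (proj_plus E a)"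
    by (simp_all add: proj_plus_def)
qed

lemma proj_star_eqI: "e \<in> E \<Longrightarrow> tilde_L E a e \<Longrightarrow> proj_star E a = e"
  using ehr tilde_L_proj_star proj_star_mem unfolding ehresmann_def by blast

lemma proj_plus_eqI: "e \<in> E \<Longrightarrow> tilde_R E a e \<Longrightarrow> proj_plus E a = e"
  using ehr tilde_R_proj_plus proj_plus_mem unfolding ehresmann_def by blast

lemma proj_idem: "e \<in> E \<Longrightarrow> e * e = e"
  using ehr by (simp add: ehresmann_def subsemilattice_def)

lemma mult_proj_star: "a * proj_star E a = a"
  using tilde_L_proj_star[of a] proj_star_mem[of a] proj_idem unfolding tilde_L_def by blast

lemma proj_plus_mult: "proj_plus E a * a = a"
  using tilde_R_proj_plus[of a] proj_plus_mem[of a] proj_idem unfolding tilde_R_def by blast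

lemma tilde_L_mult: "tilde_L E a b \<Longrightarrow> tilde_L E (a * c) (b * c)"
  and tilde_R_mult: "tilde_R E a b \<Longrightarrow> tilde_R E (c * a) (c * b)"
  using ehr by (simp_all add: ehresmann_def)

end

lemma idempotent_R_related_to_projection:
  assumes EI: "EI_ehresmann E" and rr: "right_restriction E" and f: "f * f = f"
  obtains p b where "p \<in> E" "p * f = f" "f * p * b = p"
proof -
  have ehr: "ehresmann E" using EI by (simp add: EI_ehresmann_def)
  define q p where "q = proj_star E f" and "p = proj_plus E f"
  have qE: "q \<in> E" and pE: "p \<in> E" and fq: "tilde_L E f q" and fp: "tilde_R E f p"
    by (simp_all add: q_def p_def proj_star_mem[OF ehr] proj_plus_mem[OF ehr]
        tilde_L_proj_star[OF ehr] tilde_R_proj_plus[OF ehr])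
  \<comment> \<open>Right congruence applied to \<open>f\<close> and \<open>q\<close> relates
    \<open>f * f = f\<close> to \<open>q * f\<close>, so the star of \<open>q * f\<close> is
    \<open>q\<close>. Right restriction then reads \<open>q * f = f * q\<close>, which is
    \<open>f\<close>.\<close>
  have "tilde_L E f (q * f)" using tilde_L_mult[OF ehr fq, of f] f by simp
  then have "proj_star E (q * f) = q"
    by (meson fq proj_star_eqI[OF ehr] qE tilde_L_sym tilde_L_trans)
  then have "q * f = f"
    using rr qE mult_proj_star[OF ehr, of f] by (metis q_def right_restriction_def)
  then have "q * p = p" using fp qE by (simp add: tilde_R_def)
  \<comment> \<open>For the domain, \<open>f * p\<close> is related to \<open>q * p = p\<close>. For
    the range, \<open>f\<close> and \<open>p\<close> are \<open>tilde_R\<close>-related, so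
    \<open>f * f = f\<close> and \<open>f * p\<close> are as well.\<close>
  then have "proj_star E (f * p) = p"
    using tilde_L_mult[OF ehr fq, of p] pE by (simp add: proj_star_eqI[OF ehr])
  moreover have "tilde_R E f (f * p)" using tilde_R_mult[OF ehr fp, of f] f by simp
  then have "proj_plus E (f * p) = p"
    by (meson fp pE proj_plus_eqI[OF ehr] tilde_R_sym tilde_R_trans)
  ultimately obtain b where "f * p * b = p"
    using EI unfolding EI_ehresmann_def cat_iso_def by metis
  with that pE show thesis by (simp add: p_def proj_plus_mult[OF ehr])
qed

text \<open>If \<open>a * x * a = a\<close>, then \<open>a * x\<close> is an idempotent generating
  the same right ideal as \<open>a\<close>. The projection attached to it is a right multiple of
  \<open>a\<close> and has \<open>a\<close> as a right multiple, so it lies in the same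
  class.\<close>

lemma projection_in_regular_J_class:
  assumes "EI_ehresmann E" "right_restriction E" and J: "J \<in> UNIV // green_J"
    and "\<exists>a\<in>J. regular_element a"
  shows "E \<inter> J \<noteq> {}"
proof -
  obtain a x where a: "a \<in> J" "a * x * a = a"
    using assms(4) by (auto simp: regular_element_def)
  obtain c where c: "J = green_J `` {c}" using J by (auto simp: quotient_def)
  have "(a * x) * (a * x) = a * x" using a(2) by (metis mult.assoc)
  with assms(1,2) obtain p b where p: "p \<in> E" "p * (a * x) = a * x" "a * x * p * b = p"
    by (rule idempotent_R_related_to_projection)
  have "p = a * (x * p * b)" using p(3) by (simp add: mult.assoc)
  then have "p \<in> two_sided_ideal a" unfolding two_sided_ideal_def by blast
  moreover have "a = p * (a * x * a)" using p(2) a(2) by (metis mult.assoc)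
  then have "a \<in> two_sided_ideal p" unfolding two_sided_ideal_def by blast
  ultimately have "two_sided_ideal p = two_sided_ideal a"
    by (simp add: two_sided_ideal_subset subset_antisym)
  then have "p \<in> J" using a(1) by (simp add: c green_J_def)
  with p(1) show ?thesis by blast
qed

section \<open>Group algebras\<close>

text \<open>The class of an idempotent is the group of units of the monoid
  \<open>e S e\<close>.\<close>

lemma green_H_class_iff:
  assumes e: "e * e = (e::'a::semigroup_mult)"
  shows "g \<in> green_H_class e \<longleftrightarrow>
    e * g = g \<and> g * e = g \<and> (\<exists>h. e * h = h \<and> h * e = h \<and> g * h = e \<and> h * g = e)"
proof
  assume "g \<in> green_H_class e"
  then have eq: "left_ideal g = left_ideal e" "right_ideal g = right_ideal e"
    by (simp_all add: green_H_class_def)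
  have "g \<in> left_ideal e" "g \<in> right_ideal e" using eq by (auto simp: left_ideal_def right_ideal_def)
  then obtain s t where "g = e \<or> g = s * e" "g = e \<or> g = e * t"
    unfolding left_ideal_def right_ideal_def by blast
  then have g: "g * e = g" "e * g = g"
    using e by (metis mult.assoc)+
  have "e \<in> left_ideal g" "e \<in> right_ideal g" using eq by (auto simp: left_ideal_def right_ideal_def)
  then obtain l r where "l * g = e" "g * r = e"
    using e unfolding left_ideal_def right_ideal_def by auto
  \<comment> \<open>Cut down to \<open>e S e\<close>, the left inverse and the right inverse of
    \<open>g\<close> must coincide.\<close>
  with g e have "(e * l * e) * g = e" "g * (e * r * e) = e"
    by (metis mult.assoc)+
  moreover from this have "e * l * e = e * r * e"
    by (metis e mult.assoc)
  ultimately show "e * g = g \<and> g * e = g \<and> (\<exists>h. e * h = h \<and> h * e = h \<and> g * h = e \<and> h * g = e)"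
    using e g by (metis mult.assoc)
next
  assume "e * g = g \<and> g * e = g \<and> (\<exists>h. e * h = h \<and> h * e = h \<and> g * h = e \<and> h * g = e)"
  then obtain h where "e * g = g" "g * e = g" "e * h = h" "h * e = h" "g * h = e" "h * g = e" by blast
  then have "left_ideal g = left_ideal e" "right_ideal g = right_ideal e"
    unfolding left_ideal_def right_ideal_def by (auto; metis mult.assoc)+
  then show "g \<in> green_H_class e" by (simp add: green_H_class_def)
qed

context
  fixes f g h :: "'a::{finite, semigroup_mult} \<Rightarrow> 'k::field"
begin

lemma convolution_add_left: "convolution (f + g) h = convolution f h + convolution g h"
  and convolution_add_right: "convolution f (g + h) = convolution f g + convolution f h"
  and convolution_scale_left: "convolution (fscale c f) h = fscale c (convolution f h)"
  and convolution_scale_right: "convolution f (fscale c h) = fscale c (convolution f h)"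
  by (rule ext, simp only: fun_apply convolution_def case_prod_unfold
      distrib_left distrib_right sum.distrib sum_distrib_left mult.assoc mult.left_commute)+

end

lemma convolution_sum_left: "convolution (sum F I) h = (\<Sum>i\<in>I. convolution (F i) h)"
  and convolution_sum_right: "convolution h (sum F I) = (\<Sum>i\<in>I. convolution h (F i))"
proof -
  have 0: "convolution 0 h = 0" "convolution h 0 = 0"
    by (auto simp: convolution_def fun_eq_iff fun_apply)
  show "convolution (sum F I) h = (\<Sum>i\<in>I. convolution (F i) h)"
    by (induction I rule: infinite_finite_induct) (simp_all add: 0 convolution_add_left)
  show "convolution h (sum F I) = (\<Sum>i\<in>I. convolution h (F i))"
    by (induction I rule: infinite_finite_induct) (simp_all add: 0 convolution_add_right)
qed

lemma convolution_single: "convolution (single a c) (single b d) = single (a * b) (c * d)"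
proof
  fix x
  have "convolution (single a c) (single b d) x =
      (\<Sum>z | fst z * snd z = x. if z = (a, b) then c * d else 0)"
    unfolding convolution_def case_prod_unfold
    by (intro sum.cong) (auto simp: single_apply prod_eq_iff)
  also have "\<dots> = single (a * b) (c * d) x"
    by (auto simp: single_apply)
  finally show "convolution (single a c) (single b d) x = single (a * b) (c * d) x" .
qed

lemma convolution_expand_left:
    "convolution f g = (\<Sum>a\<in>UNIV. fscale (f a) (convolution (single a 1) g))"
  and convolution_expand_right:
    "convolution f g = (\<Sum>b\<in>UNIV. fscale (g b) (convolution f (single b 1)))"
  for f g :: "'a::{finite, semigroup_mult} \<Rightarrow> 'k::field"
proof -
  have eq: "f = (\<Sum>x\<in>UNIV. fscale (f x) (single x 1))" for f :: "'a \<Rightarrow> 'k"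
    by (rule fun_eq_sum_single) auto
  show "convolution f g = (\<Sum>a\<in>UNIV. fscale (f a) (convolution (single a 1) g))"
    by (subst eq[of f]) (simp only: convolution_sum_left convolution_scale_left)
  show "convolution f g = (\<Sum>b\<in>UNIV. fscale (g b) (convolution f (single b 1)))"
    by (subst eq[of g]) (simp only: convolution_sum_right convolution_scale_right)
qed

text \<open>On point masses this is associativity of the semigroup; linear expansion then frees one
  argument at a time.\<close>

lemma convolution_assoc:
  "convolution (convolution f g) h = convolution f (convolution g h)"
  for f g h :: "'a::{finite, semigroup_mult} \<Rightarrow> 'k::field"
proof -
  have 1: "convolution (convolution f (single b 1)) (single c 1) =
      convolution f (convolution (single b 1) (single c 1))" for b c and f :: "'a \<Rightarrow> 'k"
    unfolding convolution_expand_left[of f]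
    by (simp only: convolution_sum_left convolution_scale_left convolution_single mult.assoc)
  have 2: "convolution (convolution f g) (single c 1) =
      convolution f (convolution g (single c 1))" for c and f g :: "'a \<Rightarrow> 'k"
  proof -
    have "convolution (convolution f g) (single c 1) =
        (\<Sum>b\<in>UNIV. fscale (g b) (convolution f (convolution (single b 1) (single c 1))))"
      by (subst convolution_expand_right[of f g])
        (simp only: convolution_sum_left convolution_scale_left 1)
    also have "\<dots> = convolution f (convolution g (single c 1))"
      by (subst (2) convolution_expand_left)
        (simp only: convolution_sum_right convolution_scale_right)
    finally show ?thesis .
  qed
  show ?thesis
    by (subst convolution_expand_right, subst (3) convolution_expand_right)
      (simp only: 2 convolution_sum_right convolution_scale_right)
qed

section \<open>Quotient spaces and dual bases\<close>

lemma field_module_sel [simp]: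
  "carrier field_module = UNIV" "zero field_module = 0" "add field_module = (+)"
  "module.smult field_module = (*)"
  by (simp_all add: field_module_def)

lemma field_module_vectorspace: "vectorspace class_ring (field_module :: ('k::field, 'k) module)"
proof (rule vs_criteria)
  show "\<forall>v\<in>carrier field_module. \<exists>w\<in>carrier field_module.
      v \<oplus>\<^bsub>field_module\<^esub> w = \<zero>\<^bsub>field_module :: ('k, 'k) module\<^esub>"
  proof
    fix v :: 'k
    show "\<exists>w\<in>carrier field_module. v \<oplus>\<^bsub>field_module\<^esub> w = \<zero>\<^bsub>field_module\<^esub>"
      by (rule bexI[of _ "- v"]) simp_all
  qed
qed (simp_all add: class_field distrib_left distrib_right add_ac)

lemma finsum_field_module: "finsum (field_module :: ('k::field, 'k) module) f A = sum f A"
proof -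
  interpret abelian_monoid "field_module :: ('k, 'k) module"
    by (rule abelian_monoidI) (auto simp: add_ac)
  show ?thesis
    by (induction A rule: infinite_finite_induct) (auto simp: finsum_insert)
qed

text \<open>Applying \<open>L i\<close> to a combination of the \<open>t j\<close> returns its
  coefficient at \<open>t i\<close>, so the \<open>t j\<close> are independent. They span because
  \<open>v\<close> minus the combination with coefficients \<open>L i v\<close> is killed by every
  \<open>L i\<close>.\<close>

lemma dim_dual_basis:
  fixes V :: "('k::field, 'v) module" and t :: "'i \<Rightarrow> 'v" and L :: "'i \<Rightarrow> 'v \<Rightarrow> 'k"
  assumes V: "vectorspace class_ring V" and I: "finite I"
    and t: "\<And>i. i \<in> I \<Longrightarrow> t i \<in> carrier V"
    and L: "\<And>i. i \<in> I \<Longrightarrow> L i \<in> LinearCombinations.module_hom class_ring V field_module"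
    and dual: "\<And>i j. i \<in> I \<Longrightarrow> j \<in> I \<Longrightarrow> L i (t j) = (if i = j then 1 else 0)"
    and sep: "\<And>v. v \<in> carrier V \<Longrightarrow> (\<And>i. i \<in> I \<Longrightarrow> L i v = 0) \<Longrightarrow> v = \<zero>\<^bsub>V\<^esub>"
  shows "vectorspace.fin_dim class_ring V \<and> vectorspace.dim class_ring V = card I"
proof -
  interpret V: vectorspace class_ring V by (rule V)
  have lin: "linear_map class_ring V field_module (L i)" if "i \<in> I" for i
    by (intro linear_map.intro mod_hom.intro mod_hom_axioms.intro V field_module_vectorspace
        L[OF that] vectorspace.axioms(1))
  have inj: "inj_on t I"
  proof (rule inj_onI, rule ccontr)
    fix i j assume "i \<in> I" "j \<in> I" "t i = t j" "i \<noteq> j"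
    then show False using dual[of i i] dual[of i j] by simp
  qed
  have sub: "t ` I \<subseteq> carrier V" using t by auto
  have L_zero: "L i \<zero>\<^bsub>V\<^esub> = 0" if "i \<in> I" for i
  proof -
    interpret L: linear_map class_ring V field_module "L i" by (rule lin[OF that])
    show ?thesis using L.T0_is_0 by simp
  qed
  have L_lincomb: "L i (V.lincomb a (t ` I)) = a (t i)" if i: "i \<in> I" for i a
  proof -
    interpret L: linear_map class_ring V field_module "L i" by (rule lin[OF i])
    have "L i (V.lincomb a (t ` I)) = (\<Sum>v\<in>t ` I. L i (a v \<odot>\<^bsub>V\<^esub> v))"
      unfolding V.lincomb_def using sub
      by (subst L.hom_sum) (auto simp: finsum_field_module)
    also have "\<dots> = (\<Sum>v\<in>t ` I. a v * L i v)"
      using sub by (intro sum.cong) (auto simp: L.f_smult)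
    also have "\<dots> = (\<Sum>j\<in>I. if i = j then a (t j) else 0)"
      using inj by (simp add: sum.reindex dual i if_distrib cong: if_cong)
    also have "\<dots> = a (t i)" using I i by simp
    finally show ?thesis .
  qed
  have "V.lin_indpt (t ` I)"
    by (rule V.finite_lin_indpt2) (use I sub L_zero in \<open>auto simp flip: L_lincomb\<close>)
  moreover have "v \<in> V.span (t ` I)" if v: "v \<in> carrier V" for v
  proof -
    \<comment> \<open>Linear combinations take coefficients indexed by vectors, so the coefficient
      \<open>L i v\<close> is attached to \<open>t i\<close> through the inverse of
      \<open>t\<close>.\<close>
    define a where "a = (\<lambda>u. L (inv_into I t u) v)"
    let ?w = "V.lincomb a (t ` I)"
    have w: "?w \<in> carrier V" using sub by simp
    have "v \<ominus>\<^bsub>V\<^esub> ?w = \<zero>\<^bsub>V\<^esub>"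
    proof (rule sep)
      fix i assume i: "i \<in> I"
      interpret L: linear_map class_ring V field_module "L i" by (rule lin[OF i])
      have "L i v = L i ((v \<ominus>\<^bsub>V\<^esub> ?w) \<oplus>\<^bsub>V\<^esub> ?w)"
        using v w by (simp add: V.M.minus_eq V.M.a_assoc V.M.l_neg)
      also have "\<dots> = L i (v \<ominus>\<^bsub>V\<^esub> ?w) + L i ?w"
        using v w by (subst L.f_add) simp_all
      also have "L i ?w = L i v"
        using i inj by (simp add: L_lincomb a_def)
      finally show "L i (v \<ominus>\<^bsub>V\<^esub> ?w) = 0" by simp
    qed (use v w in simp)
    then have "v = ?w" using v w by simp
    then show ?thesis using I by (auto simp: V.span_def)
  qed
  then have "V.gen_set (t ` I)" using V.span_is_subset2[OF sub] by blast
  ultimately have "V.basis (t ` I)" using sub by (simp add: V.basis_def)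
  then have "V.dim = card (t ` I)"
    by (rule V.dim_basis[OF finite_imageI[OF I]])
  moreover have V.fin_dim
    unfolding V.fin_dim_def using I sub \<open>V.gen_set (t ` I)\<close> by blast
  ultimately show ?thesis by (simp only: card_image[OF inj])
qed

section \<open>The quotient by a subspace as a vector space\<close>

locale vs_quotient = vectorspace K V for K (structure) and V (structure) +
  fixes N
  assumes N: "LinearCombinations.submodule K N V"
begin

lemma N_subset: "N \<subseteq> carrier V"
  using N by (simp add: LinearCombinations.submodule_def)

sublocale q: abelian_subgroup N V
proof (rule abelian_subgroupI3)
  have "subgroup N (add_monoid V)"
  proof
    fix x assume x: "x \<in> N"
    then have "(\<ominus>\<^bsub>K\<^esub> \<one>\<^bsub>K\<^esub>) \<odot>\<^bsub>V\<^esub> x \<in> N"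
      using N by (simp add: LinearCombinations.submodule_def)
    then show "inv\<^bsub>add_monoid V\<^esub> x \<in> N"
      using x N_subset by (simp add: smult_minus_1 subset_iff flip: a_inv_def)
  qed (use N in \<open>auto simp: LinearCombinations.submodule_def\<close>)
  then show "additive_subgroup N V" by (rule additive_subgroup.intro)
  show "abelian_group V" by unfold_locales
qed

abbreviation "Q \<equiv> quotient_space V N"

lemma quotient_sel [simp]:
  "carrier Q = a_rcosets\<^bsub>V\<^esub> N" "\<zero>\<^bsub>Q\<^esub> = N" "add Q = set_add V"
  "module.smult Q = (\<lambda>c S. set_add V N ((\<lambda>x. c \<odot>\<^bsub>V\<^esub> x) ` S))"
  by (simp_all add: quotient_space_def)

lemma mem_quotient_iff: "S \<in> carrier Q \<longleftrightarrow> (\<exists>x\<in>carrier V. S = N +>\<^bsub>V\<^esub> x)"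
  by (auto simp: A_RCOSETS_defs a_r_coset_def r_coset_def)

lemma quotient_rep:
  assumes "S \<in> carrier Q"
  obtains x where "x \<in> carrier V" "S = N +>\<^bsub>V\<^esub> x"
  using assms mem_quotient_iff by auto

lemma quotient_add:
  "x \<in> carrier V \<Longrightarrow> y \<in> carrier V \<Longrightarrow> (N +>\<^bsub>V\<^esub> x) \<oplus>\<^bsub>Q\<^esub> (N +>\<^bsub>V\<^esub> y) = N +>\<^bsub>V\<^esub> (x \<oplus>\<^bsub>V\<^esub> y)"
  by (simp add: q.a_rcos_sum)

text \<open>For \<open>c = 0\<close> the image of a coset is only the zero vector; adding
  \<open>N\<close> in the definition makes it a full coset again. In general m + c (n + x) = (m + c
  n) + c x, with m + c n in \<open>N\<close>.\<close>

lemma quotient_smult: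
  assumes c: "c \<in> carrier K" and x: "x \<in> carrier V"
  shows "c \<odot>\<^bsub>Q\<^esub> (N +>\<^bsub>V\<^esub> x) = N +>\<^bsub>V\<^esub> (c \<odot>\<^bsub>V\<^esub> x)"
proof -
  have "set_add V N ((\<lambda>y. c \<odot>\<^bsub>V\<^esub> y) ` (N +>\<^bsub>V\<^esub> x)) = N +>\<^bsub>V\<^esub> (c \<odot>\<^bsub>V\<^esub> x)"
  proof (intro equalityI subsetI)
    fix z assume "z \<in> set_add V N ((\<lambda>y. c \<odot>\<^bsub>V\<^esub> y) ` (N +>\<^bsub>V\<^esub> x))"
    then obtain m n where mn: "m \<in> N" "n \<in> N" "z = m \<oplus>\<^bsub>V\<^esub> c \<odot>\<^bsub>V\<^esub> (n \<oplus>\<^bsub>V\<^esub> x)"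
      by (auto simp: set_add_def set_mult_def a_r_coset_def r_coset_def)
    then have "z = (m \<oplus>\<^bsub>V\<^esub> c \<odot>\<^bsub>V\<^esub> n) \<oplus>\<^bsub>V\<^esub> c \<odot>\<^bsub>V\<^esub> x"
      using c x N_subset by (simp add: smult_r_distr M.a_assoc subset_iff)
    moreover have "m \<oplus>\<^bsub>V\<^esub> c \<odot>\<^bsub>V\<^esub> n \<in> N"
      using mn c N by (simp add: LinearCombinations.submodule_def)
    ultimately show "z \<in> N +>\<^bsub>V\<^esub> (c \<odot>\<^bsub>V\<^esub> x)"
      by (auto simp: a_r_coset_def r_coset_def)
  next
    fix z assume "z \<in> N +>\<^bsub>V\<^esub> (c \<odot>\<^bsub>V\<^esub> x)"
    then obtain m where m: "m \<in> N" "z = m \<oplus>\<^bsub>V\<^esub> c \<odot>\<^bsub>V\<^esub> x"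
      by (auto simp: a_r_coset_def r_coset_def)
    moreover have "x \<in> N +>\<^bsub>V\<^esub> x" using x by (rule q.a_rcos_self)
    ultimately show "z \<in> set_add V N ((\<lambda>y. c \<odot>\<^bsub>V\<^esub> y) ` (N +>\<^bsub>V\<^esub> x))"
      by (auto simp: set_add_def set_mult_def)
  qed
  then show ?thesis by simp
qed

lemma quotient_vectorspace: "vectorspace K Q"
proof (rule vs_criteria)
  show "field K" by unfold_locales
  have mem: "N +>\<^bsub>V\<^esub> x \<in> carrier Q" if "x \<in> carrier V" for x
    using that mem_quotient_iff by blast
  have zero: "\<zero>\<^bsub>Q\<^esub> = N +>\<^bsub>V\<^esub> \<zero>\<^bsub>V\<^esub>"
    using N_subset by (simp add: M.a_coset_add_zero)
  note simps = quotient_add quotient_smult mem zero M.zero_closed M.a_closed smult_closed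
  show "\<zero>\<^bsub>Q\<^esub> \<in> carrier Q" by (simp only: simps)
  show "\<forall>v w. v \<in> carrier Q \<and> w \<in> carrier Q \<longrightarrow> v \<oplus>\<^bsub>Q\<^esub> w \<in> carrier Q"
    by (intro allI impI, elim conjE quotient_rep, simp only: simps)
  show "\<forall>v\<in>carrier Q. \<exists>w\<in>carrier Q. v \<oplus>\<^bsub>Q\<^esub> w = \<zero>\<^bsub>Q\<^esub>"
  proof
    fix v assume "v \<in> carrier Q"
    then obtain x where "x \<in> carrier V" "v = N +>\<^bsub>V\<^esub> x" by (rule quotient_rep)
    then show "\<exists>w\<in>carrier Q. v \<oplus>\<^bsub>Q\<^esub> w = \<zero>\<^bsub>Q\<^esub>"
      by (intro bexI[of _ "N +>\<^bsub>V\<^esub> (\<ominus>\<^bsub>V\<^esub> x)"]) (simp_all only: simps M.a_inv_closed M.r_neg)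
  qed
  show "\<forall>c v. c \<in> carrier K \<and> v \<in> carrier Q \<longrightarrow> c \<odot>\<^bsub>Q\<^esub> v \<in> carrier Q"
    by (intro allI impI, elim conjE quotient_rep, simp only: simps)
  show "\<forall>v w. v \<in> carrier Q \<and> w \<in> carrier Q \<longrightarrow> v \<oplus>\<^bsub>Q\<^esub> w = w \<oplus>\<^bsub>Q\<^esub> v"
    by (intro allI impI, elim conjE quotient_rep, simp only: simps M.a_comm)
  show "\<forall>v w x. v \<in> carrier Q \<and> w \<in> carrier Q \<and> x \<in> carrier Q \<longrightarrow>
      v \<oplus>\<^bsub>Q\<^esub> w \<oplus>\<^bsub>Q\<^esub> x = v \<oplus>\<^bsub>Q\<^esub> (w \<oplus>\<^bsub>Q\<^esub> x)"
    by (intro allI impI, elim conjE quotient_rep, simp only: simps M.a_assoc)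
  show "\<forall>v\<in>carrier Q. v \<oplus>\<^bsub>Q\<^esub> \<zero>\<^bsub>Q\<^esub> = v"
    by (intro ballI, elim quotient_rep, simp only: simps M.r_zero)
  show "\<forall>c d v. c \<in> carrier K \<and> d \<in> carrier K \<and> v \<in> carrier Q \<longrightarrow>
      (c \<otimes>\<^bsub>K\<^esub> d) \<odot>\<^bsub>Q\<^esub> v = c \<odot>\<^bsub>Q\<^esub> (d \<odot>\<^bsub>Q\<^esub> v)"
    by (intro allI impI, elim conjE quotient_rep, simp only: simps smult_assoc1 R.m_closed)
  show "\<forall>c d v. c \<in> carrier K \<and> d \<in> carrier K \<and> v \<in> carrier Q \<longrightarrow>
      (c \<oplus>\<^bsub>K\<^esub> d) \<odot>\<^bsub>Q\<^esub> v = c \<odot>\<^bsub>Q\<^esub> v \<oplus>\<^bsub>Q\<^esub> d \<odot>\<^bsub>Q\<^esub> v"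
    by (intro allI impI, elim conjE quotient_rep, simp only: simps smult_l_distr R.a_closed)
  show "\<forall>c v w. c \<in> carrier K \<and> v \<in> carrier Q \<and> w \<in> carrier Q \<longrightarrow>
      c \<odot>\<^bsub>Q\<^esub> (v \<oplus>\<^bsub>Q\<^esub> w) = c \<odot>\<^bsub>Q\<^esub> v \<oplus>\<^bsub>Q\<^esub> c \<odot>\<^bsub>Q\<^esub> w"
    by (intro allI impI, elim conjE quotient_rep, simp only: simps smult_r_distr)
  show "\<forall>v\<in>carrier Q. \<one>\<^bsub>K\<^esub> \<odot>\<^bsub>Q\<^esub> v = v"
    by (intro ballI, elim quotient_rep, simp only: simps smult_one R.one_closed)
qed

lemma quotient_coset_eq_zero: "x \<in> carrier V \<Longrightarrow> N +>\<^bsub>V\<^esub> x = \<zero>\<^bsub>Q\<^esub> \<longleftrightarrow> x \<in> N"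
  using q.a_rcos_self[of x] M.a_coset_join2[of x N] q.a_subgroup by auto

end

text \<open>The dual basis criterion with its data given on \<open>V\<close> itself: since the
  common kernel of the functionals is exactly \<open>N\<close>, they descend to the quotient and
  separate its points from zero.\<close>

lemma dim_quotient_dual_basis:
  fixes V :: "('k::field, 'v) module" and t :: "'i \<Rightarrow> 'v" and L :: "'i \<Rightarrow> 'v \<Rightarrow> 'k"
  assumes V: "vectorspace class_ring V" and N: "LinearCombinations.submodule class_ring N V"
    and I: "finite I"
    and t: "\<And>i. i \<in> I \<Longrightarrow> t i \<in> carrier V"
    and L: "\<And>i. i \<in> I \<Longrightarrow> L i \<in> LinearCombinations.module_hom class_ring V field_module"
    and dual: "\<And>i j. i \<in> I \<Longrightarrow> j \<in> I \<Longrightarrow> L i (t j) = (if i = j then 1 else 0)"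
    and sep: "\<And>v. v \<in> carrier V \<Longrightarrow> v \<in> N \<longleftrightarrow> (\<forall>i\<in>I. L i v = 0)"
  shows "vectorspace.fin_dim class_ring (quotient_space V N) \<and>
    vectorspace.dim class_ring (quotient_space V N) = card I"
proof -
  interpret V: vs_quotient class_ring V N
    using V N by (simp add: vs_quotient_def vs_quotient_axioms_def)
  \<comment> \<open>Evaluation at an arbitrary representative; the choice does not matter because
    \<open>L i\<close> vanishes on \<open>N\<close>.\<close>
  define L' where "L' i S = L i (SOME x. x \<in> S)" for i S
  have L': "L' i (N +>\<^bsub>V\<^esub> x) = L i x" if i: "i \<in> I" and x: "x \<in> carrier V" for i x
  proof -
    have "(SOME y. y \<in> N +>\<^bsub>V\<^esub> x) \<in> N +>\<^bsub>V\<^esub> x"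
      using V.q.a_rcos_self[OF x] by (rule someI)
    then obtain n where n: "n \<in> N" "(SOME y. y \<in> N +>\<^bsub>V\<^esub> x) = n \<oplus>\<^bsub>V\<^esub> x"
      by (auto simp: a_r_coset_def r_coset_def)
    then have nV: "n \<in> carrier V" using V.N_subset by blast
    then have "L i (n \<oplus>\<^bsub>V\<^esub> x) = L i n + L i x"
      using LinearCombinations.module_hom_add[OF L[OF i] nV x] by simp
    moreover have "L i n = 0" using sep[OF nV] n(1) i by blast
    ultimately show ?thesis by (simp add: L'_def n(2))
  qed
  show ?thesis
  proof (rule dim_dual_basis[OF V.quotient_vectorspace I])
    fix i assume i: "i \<in> I"
    show "N +>\<^bsub>V\<^esub> t i \<in> carrier V.Q" using t[OF i] V.mem_quotient_iff by blast
    show "L' i \<in> LinearCombinations.module_hom class_ring V.Q field_module"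
      unfolding LinearCombinations.module_hom_def
    proof (intro CollectI conjI allI impI)
      fix S T assume ST: "S \<in> carrier V.Q \<and> T \<in> carrier V.Q"
      obtain x y where "x \<in> carrier V" "S = N +>\<^bsub>V\<^esub> x" "y \<in> carrier V" "T = N +>\<^bsub>V\<^esub> y"
        by (rule V.quotient_rep[OF ST[THEN conjunct1]], rule V.quotient_rep[OF ST[THEN conjunct2]]) (rule that)
      then show "L' i (S \<oplus>\<^bsub>V.Q\<^esub> T) = L' i S \<oplus>\<^bsub>field_module\<^esub> L' i T"
        by (simp only: V.quotient_add L'[OF i] V.M.a_closed LinearCombinations.module_hom_add[OF L[OF i]])
    next
      fix c :: 'k and S assume cS: "c \<in> carrier class_ring \<and> S \<in> carrier V.Q"
      obtain x where "x \<in> carrier V" "S = N +>\<^bsub>V\<^esub> x"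
        by (rule V.quotient_rep[OF cS[THEN conjunct2]])
      then show "L' i (c \<odot>\<^bsub>V.Q\<^esub> S) = c \<odot>\<^bsub>field_module\<^esub> L' i S"
        using cS[THEN conjunct1]
        by (simp only: V.quotient_smult L'[OF i] V.smult_closed LinearCombinations.module_hom_smult[OF L[OF i]])
    qed simp
  next
    fix i j assume "i \<in> I" "j \<in> I"
    then show "L' i (N +>\<^bsub>V\<^esub> t j) = (if i = j then 1 else 0)"
      by (simp only: L' t dual)
  next
    fix S assume S: "S \<in> carrier V.Q" "\<And>i. i \<in> I \<Longrightarrow> L' i S = 0"
    obtain x where x: "x \<in> carrier V" "S = N +>\<^bsub>V\<^esub> x" using S(1) by (rule V.quotient_rep)
    have "\<forall>i\<in>I. L i x = 0" using S(2) L' x by simp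
    then have "x \<in> N" using sep x(1) by blast
    then show "S = \<zero>\<^bsub>V.Q\<^esub>" unfolding x(2) by (simp only: V.quotient_coset_eq_zero[OF x(1)])
  qed
qed

section \<open>Permutation modules with a basis acted on from the right\<close>

text \<open>Zero and addition are the constants of the function type, so that statements about
  modules reduce to \<open>fs.subspace\<close> and ordinary sums.\<close>

definition basis_module ::
  "'a::{finite, semigroup_mult} set \<Rightarrow> ('a \<Rightarrow> 'k::field, 'a \<Rightarrow> 'k) module" where
  "basis_module X = \<lparr>carrier = supported_on X, mult = undefined, one = undefined, zero = 0,
     add = (+), smult = (\<lambda>r f. convolution f r)\<rparr>"

lemma tilde_L_module_eq: "tilde_L_module E e = basis_module {a. tilde_L E a e}"
  by (simp add: tilde_L_module_def basis_module_def fun_eq_iff fun_apply)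

lemma basis_module_sel [simp]:
  "carrier (basis_module X) = supported_on X" "zero (basis_module X) = 0"
  "add (basis_module X) = (+)" "module.smult (basis_module X) r f = convolution f r"
  by (simp_all add: basis_module_def)

lemma group_algebra_sel [simp]:
  "carrier (group_algebra e) = supported_on (green_H_class e)" "zero (group_algebra e) = 0"
  "add (group_algebra e) = (+)" "mult (group_algebra e) = convolution"
  "one (group_algebra e) = single e 1"
  by (simp_all add: group_algebra_def fun_eq_iff fun_apply)

lemma supported_onD: "f \<in> supported_on X \<Longrightarrow> x \<notin> X \<Longrightarrow> f x = 0"
  by (simp add: supported_on_def)

lemma subspace_supported_on: "fs.subspace (supported_on X)"
  by (auto simp: fs.subspace_def supported_on_def fun_apply)

lemma single_mem_supported_on: "x \<in> X \<Longrightarrow> single x c \<in> supported_on X"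
  by (auto simp: supported_on_def single_apply)

lemma finsum_basis_module:
  assumes "w \<in> I \<rightarrow> supported_on X"
  shows "finsum (basis_module X) w I = sum w I"
proof -
  interpret abelian_monoid "basis_module X"
    by (rule abelian_monoidI)
      (auto simp: fs.subspace_add fs.subspace_0 subspace_supported_on add_ac)
  show ?thesis
    using assms by (induction I rule: infinite_finite_induct) (auto simp: Pi_iff finsum_insert)
qed

text \<open>What the class of \<open>e\<close> contributes to the module theory: a set on which the
  group at \<open>e\<close> acts from the right, with \<open>e\<close> as identity.\<close>

locale right_basis =
  fixes e :: "'a::{finite, semigroup_mult}" and X :: "'a set"
  assumes e_idem: "e * e = e"
    and X_mult_e: "a \<in> X \<Longrightarrow> a * e = a"
    and X_mult: "a \<in> X \<Longrightarrow> g \<in> green_H_class e \<Longrightarrow> a * g \<in> X"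
begin

abbreviation "H \<equiv> green_H_class e"

lemmas H_iff = green_H_class_iff[OF e_idem]

lemma e_mem: "e \<in> H"
  using e_idem by (auto simp: H_iff)

lemma H_mult_e: "g \<in> H \<Longrightarrow> g * e = g" and e_mult_H: "g \<in> H \<Longrightarrow> e * g = g"
  by (auto simp: H_iff)

lemma H_mult: "g \<in> H \<Longrightarrow> h \<in> H \<Longrightarrow> g * h \<in> H"
  unfolding H_iff by (metis mult.assoc)

definition g_inv :: "'a \<Rightarrow> 'a" where
  "g_inv g = (SOME h. h \<in> H \<and> g * h = e \<and> h * g = e)"

lemma g_inv:
  assumes "g \<in> H"
  shows "g_inv g \<in> H" "g * g_inv g = e" "g_inv g * g = e"
proof -
  have "\<exists>h. h \<in> H \<and> g * h = e \<and> h * g = e"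
    using assms by (auto simp: H_iff)
  from someI_ex[OF this] show "g_inv g \<in> H" "g * g_inv g = e" "g_inv g * g = e"
    by (simp_all add: g_inv_def)
qed

text \<open>In a group, \<open>(h g)^-1 h = g^-1\<close>. This is the substitution behind the
  equivariance of averages.\<close>

lemma g_inv_mult:
  assumes "g \<in> H" "h \<in> H"
  shows "g_inv (h * g) * h = g_inv g"
proof -
  have "g_inv (h * g) * h = g_inv (h * g) * h * (g * g_inv g)"
    using assms by (simp add: g_inv H_mult_e mult.assoc)
  also have "\<dots> = g_inv (h * g) * (h * g) * g_inv g" by (simp only: mult.assoc)
  also have "\<dots> = g_inv g" using assms by (simp add: g_inv H_mult e_mult_H)
  finally show ?thesis .
qed

lemma is_subgroup_H: "is_subgroup H"
proof -
  have "group \<lparr>carrier = H, mult = (*), one = e\<rparr>"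
    by (rule groupI) (auto simp: H_mult e_mem e_mult_H mult.assoc intro: g_inv)
  then show ?thesis unfolding is_subgroup_def by blast
qed

lemma bij_betw_H_mult:
  assumes "h \<in> H"
  shows "bij_betw (\<lambda>g. h * g) H H"
proof (rule bij_betwI)
  have "g_inv h * (h * g) = g" "h * (g_inv h * g) = g" if "g \<in> H" for g
    using assms that by (simp_all add: g_inv e_mult_H flip: mult.assoc)
  then show "\<And>g. g \<in> H \<Longrightarrow> g_inv h * (h * g) = g" "\<And>g. g \<in> H \<Longrightarrow> h * (g_inv h * g) = g"
    by auto
qed (use assms in \<open>auto simp: H_mult g_inv\<close>)

lemma convolution_supported:
  assumes f: "f \<in> supported_on X" and r: "r \<in> supported_on H"
  shows "convolution f r \<in> supported_on X"
proof -
  have "convolution f r x = 0" if "x \<notin> X" for x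
    unfolding convolution_def
  proof (rule sum.neutral, clarify)
    fix a b assume "x = a * b"
    with that X_mult have "a \<notin> X \<or> b \<notin> H" by auto
    then show "f a * r b = 0" using supported_onD[OF f] supported_onD[OF r] by auto
  qed
  then show ?thesis by (simp add: supported_on_def)
qed

text \<open>Embedded scalars act by \<open>fscale\<close> because \<open>e\<close> fixes the basis
  \<open>X\<close>; hence submodules over the group algebra are subspaces.\<close>

lemma convolution_single_e:
  assumes f: "f \<in> supported_on X"
  shows "convolution f (single e c) = fscale c f"
proof -
  have "convolution f (single e c) = (\<Sum>a\<in>UNIV. fscale (f a) (single (a * e) (1 * c)))"
    by (subst convolution_expand_left) (simp only: convolution_single)
  also have "\<dots> = (\<Sum>a\<in>UNIV. fscale c (fscale (f a) (single a 1)))"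
  proof (rule sum.cong)
    fix a show "fscale (f a) (single (a * e) (1 * c)) = fscale c (fscale (f a) (single a 1))"
      by (cases "a \<in> X")
        (auto simp: X_mult_e supported_onD[OF f] fun_eq_iff fun_apply single_apply)
  qed simp
  also have "\<dots> = fscale c f"
    unfolding fs.scale_sum_right[symmetric] by (subst (2) fun_eq_sum_single[of UNIV f]) auto
  finally show ?thesis .
qed

section \<open>Submodules as subspaces stable under the group\<close>

definition g_submodule :: "('a \<Rightarrow> 'k::field) set \<Rightarrow> bool" where
  "g_submodule P \<longleftrightarrow> fs.subspace P \<and> P \<subseteq> supported_on X \<and>
     (\<forall>p\<in>P. \<forall>g\<in>H. convolution p (single g 1) \<in> P)"

definition g_simple :: "('a \<Rightarrow> 'k::field) set \<Rightarrow> bool" where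
  "g_simple P \<longleftrightarrow> P \<noteq> {0} \<and> (\<forall>Q. g_submodule Q \<and> Q \<subseteq> P \<longrightarrow> Q = {0} \<or> Q = P)"

lemma g_submodule_subspace: "g_submodule P \<Longrightarrow> fs.subspace P"
  and g_submodule_subset: "g_submodule P \<Longrightarrow> P \<subseteq> supported_on X"
  by (simp_all add: g_submodule_def)

lemma g_submodule_supported_on: "g_submodule (supported_on X)"
  by (simp add: g_submodule_def subspace_supported_on convolution_supported single_mem_supported_on)

text \<open>Stability under group elements suffices: an element of the group algebra is a linear
  combination of them, and \<open>P\<close> is a subspace.\<close>

lemma g_submodule_convolution:
  assumes P: "g_submodule P" and "p \<in> P" and r: "r \<in> supported_on H"
  shows "convolution p r \<in> P"
proof (subst convolution_expand_right, rule fs.subspace_sum)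
  show "fs.subspace P" using P by (simp add: g_submodule_def)
  fix h show "fscale (r h) (convolution p (single h 1)) \<in> P"
    using assms supported_onD[OF r, of h]
    by (cases "h \<in> H") (auto simp: g_submodule_def fs.subspace_scale fs.subspace_0)
qed

lemma submodule_iff:
  assumes P: "g_submodule P"
  shows "Module.submodule Q (group_algebra e) (basis_module X\<lparr>carrier := P\<rparr>) \<longleftrightarrow>
    g_submodule Q \<and> Q \<subseteq> P" (is "Module.submodule Q ?R ?M \<longleftrightarrow> _")
proof
  assume *: "Module.submodule Q ?R ?M"
  then have sub: "Q \<subseteq> P" and add: "\<And>x y. x \<in> Q \<Longrightarrow> y \<in> Q \<Longrightarrow> x + y \<in> Q" and zero: "0 \<in> Q"
    and smult: "\<And>r x. r \<in> supported_on H \<Longrightarrow> x \<in> Q \<Longrightarrow> convolution x r \<in> Q"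
    by (auto simp: Module.submodule_def Module.submodule_axioms_def subgroup_def)
  have supp: "Q \<subseteq> supported_on X" using sub P by (auto simp: g_submodule_def)
  have "fscale c x \<in> Q" if "x \<in> Q" for c x
    using smult[OF single_mem_supported_on[OF e_mem] that, of c] that supp
    by (auto simp: convolution_single_e)
  with add zero have "fs.subspace Q" by (auto intro: fs.subspaceI)
  with supp smult sub show "g_submodule Q \<and> Q \<subseteq> P"
    by (simp add: g_submodule_def single_mem_supported_on)
next
  assume Q: "g_submodule Q \<and> Q \<subseteq> P"
  then have sQ: "fs.subspace Q" by (simp add: g_submodule_def)
  \<comment> \<open>The inverse in the record is a description over its carrier \<open>P\<close>;
    pointwise negation satisfies it because \<open>- x\<close> lies in \<open>P\<close>.\<close>
  have inv: "m_inv (add_monoid ?M) x = - x" if "x \<in> Q" for x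
  proof -
    have "- x \<in> P" using Q sQ that fs.subspace_neg by blast
    then show ?thesis
      unfolding m_inv_def by (intro the_equality) (simp, rule minus_unique[symmetric], simp)
  qed
  show "Module.submodule Q ?R ?M"
    using Q sQ g_submodule_convolution
    by (auto simp: Module.submodule_def Module.submodule_axioms_def subgroup_def inv[simplified]
        fs.subspace_add fs.subspace_0 fs.subspace_neg)
qed

lemma simple_module_iff:
  assumes "g_submodule P"
  shows "simple_module (group_algebra e) (basis_module X\<lparr>carrier := P\<rparr>) \<longleftrightarrow> g_simple P"
  by (simp add: simple_module_def g_simple_def submodule_iff[OF assms])

lemma basis_module_update [simp]: "basis_module X\<lparr>carrier := supported_on X\<rparr> = basis_module X"
  by (simp add: basis_module_def)

lemmas submodule_basis_module_iff =
  submodule_iff[OF g_submodule_supported_on, unfolded basis_module_update]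

text \<open>\<open>finsum\<close> is rewritten as an ordinary sum only for families in the carrier,
  so the uniqueness clause is treated under the assumption that the \<open>W i\<close> are
  submodules.\<close>

lemma simple_decomposition_iff:
  "simple_decomposition (group_algebra e) (basis_module X) n W \<longleftrightarrow>
    (\<forall>i<n. g_submodule (W i) \<and> g_simple (W i)) \<and>
    (\<forall>x\<in>supported_on X. \<exists>!w. w \<in> (\<Pi>\<^sub>E i\<in>{..<n}. W i) \<and> x = (\<Sum>i<n. w i))"
proof -
  have *: "(\<forall>i<n. Module.submodule (W i) (group_algebra e) (basis_module X) \<and>
      simple_module (group_algebra e) (basis_module X\<lparr>carrier := W i\<rparr>)) \<longleftrightarrow>
    (\<forall>i<n. g_submodule (W i) \<and> g_simple (W i))"
    using simple_module_iff g_submodule_subset unfolding submodule_basis_module_iff by blast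
  have sum: "(\<Oplus>\<^bsub>basis_module X\<^esub>i\<in>{..<n}. w i) = (\<Sum>i<n. w i)"
    if W: "\<forall>i<n. g_submodule (W i) \<and> g_simple (W i)" and w: "w \<in> (\<Pi>\<^sub>E i\<in>{..<n}. W i)" for w
  proof (rule finsum_basis_module, rule Pi_I)
    fix i assume "i \<in> {..<n}"
    then show "w i \<in> supported_on X"
      using W g_submodule_subset[of "W i"] PiE_mem[OF w] by blast
  qed
  have "w \<in> (\<Pi>\<^sub>E i\<in>{..<n}. W i) \<and> x = (\<Oplus>\<^bsub>basis_module X\<^esub>i\<in>{..<n}. w i) \<longleftrightarrow>
      w \<in> (\<Pi>\<^sub>E i\<in>{..<n}. W i) \<and> x = (\<Sum>i<n. w i)"
    if "\<forall>i<n. g_submodule (W i) \<and> g_simple (W i)" for w x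
    using sum[OF that] by (cases "w \<in> (\<Pi>\<^sub>E i\<in>{..<n}. W i)") (simp_all only: simp_thms)
  then have "(\<forall>x\<in>supported_on X. \<exists>!w. w \<in> (\<Pi>\<^sub>E i\<in>{..<n}. W i) \<and>
        x = (\<Oplus>\<^bsub>basis_module X\<^esub>i\<in>{..<n}. w i)) \<longleftrightarrow>
      (\<forall>x\<in>supported_on X. \<exists>!w. w \<in> (\<Pi>\<^sub>E i\<in>{..<n}. W i) \<and> x = (\<Sum>i<n. w i))"
    if "\<forall>i<n. g_submodule (W i) \<and> g_simple (W i)"
    using that by (simp only:)
  then show ?thesis
    unfolding simple_decomposition_def * basis_module_sel by argo
qed

subsection \<open>Complete reducibility\<close>

text \<open>Averaging a linear retraction onto \<open>Q\<close> over the group makes it equivariant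
  while it still fixes \<open>Q\<close>; the kernel of the average inside \<open>P\<close> is the
  complement.\<close>

lemma maschke_complement:
  fixes P Q :: "('a \<Rightarrow> 'k::field) set"
  assumes card: "(of_nat (card H) :: 'k) \<noteq> 0"
    and P: "g_submodule P" and Q: "g_submodule Q" and QP: "Q \<subseteq> P"
  obtains C where "g_submodule C" "C \<subseteq> P" "Q \<inter> C = {0}" "\<And>p. p \<in> P \<Longrightarrow> \<exists>q\<in>Q. \<exists>c\<in>C. p = q + c"
proof -
  have sQ: "fs.subspace Q" and sP: "fs.subspace P" using P Q by (simp_all add: g_submodule_def)
  obtain \<pi> where \<pi>: "range \<pi> \<subseteq> Q" "Vector_Spaces.linear fscale fscale \<pi>" "\<And>q. q \<in> Q \<Longrightarrow> \<pi> q = q"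
    using fs_pair.linear_exists_left_inverse_on[OF fs.linear_id sQ] by auto
  \<comment> \<open>The average of the maps sending \<open>m\<close> to
    \<open>\<pi> (m g) g^-1\<close>. The factor in front makes it the identity on \<open>Q\<close>,
    for which the group order has to be nonzero in the field.\<close>
  define avg where "avg m = fscale (1 / of_nat (card H))
    (\<Sum>g\<in>H. convolution (\<pi> (convolution m (single g 1))) (single (g_inv g) 1))" for m
  have avg_Q: "avg m \<in> Q" for m
    unfolding avg_def using \<pi>(1) Q sQ
    by (intro fs.subspace_scale fs.subspace_sum)
      (auto simp: g_submodule_def g_inv range_subsetD)
  have avg_id: "avg q = q" if q: "q \<in> Q" for q
  proof -
    have "convolution (\<pi> (convolution q (single g 1))) (single (g_inv g) 1) = q" if g: "g \<in> H" for g
    proof -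
      have "convolution q (single g 1) \<in> Q" using g q Q by (simp add: g_submodule_def)
      moreover have "q \<in> supported_on X" using q Q by (auto simp: g_submodule_def)
      ultimately show ?thesis
        using g by (simp add: \<pi>(3) convolution_assoc convolution_single g_inv convolution_single_e)
    qed
    then have "avg q = fscale (1 / of_nat (card H)) (\<Sum>g\<in>H. q)"
      by (simp add: avg_def)
    also have "(\<Sum>g\<in>H. q) = fscale (of_nat (card H)) q"
      by (rule ext) (simp add: fun_apply)
    finally show ?thesis using card by simp
  qed
  have avg_add: "avg (m + m') = avg m + avg m'" for m m'
    unfolding avg_def
    by (simp only: convolution_add_left fs_pair.linear_add[OF \<pi>(2)] sum.distrib fs.scale_right_distrib)
  have avg_scale: "avg (fscale c m) = fscale c (avg m)" for c m
    unfolding avg_def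
    by (simp only: convolution_scale_left fs_pair.linear_scale[OF \<pi>(2)] fs.scale_sum_right
        fs.scale_scale mult.commute)
  have avg_mult: "avg (convolution m (single h 1)) = convolution (avg m) (single h 1)"
    if h: "h \<in> H" for m h
  proof -
    \<comment> \<open>Since \<open>g^-1 = (h g)^-1 h\<close>, the summand of the average of
      \<open>m h\<close> at \<open>g\<close> is \<open>?F\<close> at \<open>h g\<close>; summing
      over the whole group removes the shift.\<close>
    let ?F = "\<lambda>g. convolution (\<pi> (convolution m (single g 1))) (single (g_inv g * h) 1)"
    have "(\<Sum>g\<in>H. convolution (\<pi> (convolution (convolution m (single h 1)) (single g 1)))
        (single (g_inv g) 1)) = (\<Sum>g\<in>H. ?F (h * g))"
      by (rule sum.cong)
        (use h in \<open>simp_all add: convolution_assoc convolution_single g_inv_mult\<close>)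
    also have "\<dots> = (\<Sum>g\<in>H. ?F g)"
      by (rule sum.reindex_bij_betw[OF bij_betw_H_mult[OF h]])
    also have "\<dots> = convolution (\<Sum>g\<in>H. convolution (\<pi> (convolution m (single g 1)))
        (single (g_inv g) 1)) (single h 1)"
      by (simp only: convolution_sum_left convolution_assoc convolution_single mult_1)
    finally show ?thesis by (simp only: avg_def convolution_scale_left)
  qed
  define C where "C = {m \<in> P. avg m = 0}"
  show thesis
  proof
    show "C \<subseteq> P" by (auto simp: C_def)
    have zero: "avg 0 = 0" using avg_scale[of 0 0] by simp
    have "fs.subspace C"
      using sP by (intro fs.subspaceI)
        (auto simp: C_def zero avg_add avg_scale fs.subspace_0 fs.subspace_add fs.subspace_scale)
    moreover have "convolution 0 r = 0" for r :: "'a \<Rightarrow> 'k"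
      using convolution_sum_left[of _ "{}" r] by simp
    ultimately show "g_submodule C"
      using P by (auto simp: g_submodule_def C_def avg_mult)
    show "Q \<inter> C = {0}"
      using avg_id zero sP sQ by (auto simp: C_def fs.subspace_0)
    fix p assume p: "p \<in> P"
    have "avg (p + fscale (-1) (avg p)) = avg p + fscale (-1) (avg (avg p))"
      by (simp only: avg_scale avg_add)
    also have "\<dots> = 0" by (simp add: avg_id[OF avg_Q])
    finally have "p - avg p \<in> C"
      using p avg_Q QP sP by (auto simp: C_def fs.subspace_diff subset_iff)
    then show "\<exists>q\<in>Q. \<exists>c\<in>C. p = q + c"
      using avg_Q[of p] by (intro bexI[of _ "avg p"] bexI[of _ "p - avg p"]) auto
  qed
qed

lemma minimal_g_submodule:
  fixes P :: "('a \<Rightarrow> 'k::field) set"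
  assumes P: "g_submodule P" and "P \<noteq> {0}"
  obtains S where "g_submodule S" "S \<subseteq> P" "g_simple S"
proof -
  define \<Q> where "\<Q> = (\<lambda>Q. g_submodule Q \<and> Q \<subseteq> P \<and> Q \<noteq> {0})"
  have "\<Q> P" using assms by (simp add: \<Q>_def)
  then obtain S where S: "\<Q> S" "\<And>Q. \<Q> Q \<Longrightarrow> fs.dim S \<le> fs.dim Q"
    using ex_has_least_nat[of \<Q> P fs.dim] by blast
  have "Q = S" if Q: "g_submodule Q" "Q \<subseteq> S" "Q \<noteq> {0}" for Q
  proof -
    have "\<Q> Q" using Q S(1) by (auto simp: \<Q>_def)
    with S Q show ?thesis
      by (intro fin_fs.subspace_dim_equal) (auto simp: g_submodule_def \<Q>_def)
  qed
  then have "g_simple S" using S(1) by (auto simp: g_simple_def \<Q>_def)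
  with that S(1) show thesis by (auto simp: \<Q>_def)
qed

text \<open>Induction on the dimension: split off a simple submodule and decompose its complement.
  Uniqueness of components is carried as independence, and families are arbitrary outside
  \<open>{..<n}\<close>, which makes it easy to append a summand.\<close>

lemma simple_summands_exist:
  fixes P :: "('a \<Rightarrow> 'k::field) set"
  assumes card: "(of_nat (card H) :: 'k) \<noteq> 0" and "g_submodule P"
  shows "\<exists>n W. (\<forall>i<n::nat. g_submodule (W i) \<and> g_simple (W i) \<and> W i \<subseteq> P) \<and>
    (\<forall>x\<in>P. \<exists>w. (\<forall>i<n. w i \<in> W i) \<and> x = (\<Sum>i<n. w i)) \<and>
    (\<forall>w. (\<forall>i<n. w i \<in> W i) \<and> (\<Sum>i<n. w i) = 0 \<longrightarrow> (\<forall>i<n. w i = 0))"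
  using assms(2)
proof (induction "fs.dim P" arbitrary: P rule: less_induct)
  case less
  show ?case
  proof (cases "P = {0}")
    case True
    then show ?thesis by (intro exI[of _ 0]) auto
  next
    case False
    with less.prems obtain S where S: "g_submodule S" "S \<subseteq> P" "g_simple S"
      by (rule minimal_g_submodule)
    obtain C where C: "g_submodule C" "C \<subseteq> P" "S \<inter> C = {0}"
        "\<And>p. p \<in> P \<Longrightarrow> \<exists>s\<in>S. \<exists>c\<in>C. p = s + c"
      using maschke_complement[OF card less.prems S(1,2)] by metis
    have sS: "fs.subspace S" and sC: "fs.subspace C" and sP: "fs.subspace P"
      using S C less.prems by (simp_all add: g_submodule_def)
    have "S \<noteq> {0}" using S(3) by (simp add: g_simple_def)
    with S(2) C(2,3) have "C \<subset> P" by blast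
    then have "fs.dim C < fs.dim P"
      using sC sP by (intro fin_fs.dim_psubset) (simp add: fs.span_eq_iff[THEN iffD2])
    from less.hyps[OF this C(1)] obtain n and W :: "nat \<Rightarrow> ('a \<Rightarrow> 'k) set" where
      W: "\<forall>i<n. g_submodule (W i) \<and> g_simple (W i) \<and> W i \<subseteq> C" and
      ex: "\<forall>x\<in>C. \<exists>w. (\<forall>i<n. w i \<in> W i) \<and> x = (\<Sum>i<n. w i)" and
      indep: "\<forall>w. (\<forall>i<n. w i \<in> W i) \<and> (\<Sum>i<n. w i) = 0 \<longrightarrow> (\<forall>i<n. w i = 0)"
      by (elim exE conjE) (rule that)
    let ?W = "W(n := S)"
    show ?thesis
    proof (intro exI[of _ "Suc n"] exI[of _ ?W] conjI ballI allI impI)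
      fix i assume "i < Suc n"
      then show "g_submodule (?W i)" "g_simple (?W i)" "?W i \<subseteq> P"
        using W S C(2) by (auto simp: less_Suc_eq)
    next
      fix x assume "x \<in> P"
      then obtain s c where sc: "s \<in> S" "c \<in> C" "x = s + c" using C(4) by blast
      obtain w where w: "\<forall>i<n. w i \<in> W i" "c = (\<Sum>i<n. w i)" using ex sc(2) by blast
      have "(\<Sum>i<Suc n. (w(n := s)) i) = x"
        using sc w by (simp add: add.commute)
      then show "\<exists>w. (\<forall>i<Suc n. w i \<in> ?W i) \<and> x = (\<Sum>i<Suc n. w i)"
        using w sc by (intro exI[of _ "w(n := s)"]) (auto simp: less_Suc_eq)
    next
      fix w i assume w: "(\<forall>i<Suc n. w i \<in> ?W i) \<and> (\<Sum>i<Suc n. w i) = 0" and i: "i < Suc n"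
      have wW: "\<forall>i<n. w i \<in> W i" "w n \<in> S"
        using w by (auto simp: less_Suc_eq split: if_splits)
      then have sumC: "(\<Sum>i<n. w i) \<in> C"
        using W by (intro fs.subspace_sum[OF sC]) auto
      \<comment> \<open>The last component is minus the sum of the others, so it lies in both
        \<open>S\<close> and \<open>C\<close> and vanishes.\<close>
      have "w n = - (\<Sum>i<n. w i)" using w by (simp add: add_eq_0_iff)
      then have "w n \<in> C" using sumC sC fs.subspace_neg by metis
      then have n: "w n = 0" using wW(2) C(3) by blast
      then have "(\<Sum>i<n. w i) = 0" using w by simp
      then have "\<forall>i<n. w i = 0" using indep wW(1) by blast
      with n i show "w i = 0" by (auto simp: less_Suc_eq)
    qed
  qed
qed

lemma simple_decomposition_exists:
  assumes "(of_nat (card H) :: 'k::field) \<noteq> 0"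
  shows "\<exists>n W. simple_decomposition (group_algebra e :: ('a \<Rightarrow> 'k) ring) (basis_module X) n W"
proof -
  obtain n and W :: "nat \<Rightarrow> ('a \<Rightarrow> 'k) set" where
    W: "\<forall>i<n. g_submodule (W i) \<and> g_simple (W i) \<and> W i \<subseteq> supported_on X" and
    ex: "\<forall>x\<in>supported_on X. \<exists>w. (\<forall>i<n. w i \<in> W i) \<and> x = (\<Sum>i<n. w i)" and
    indep: "\<forall>w. (\<forall>i<n. w i \<in> W i) \<and> (\<Sum>i<n. w i) = 0 \<longrightarrow> (\<forall>i<n. w i = 0)"
    using simple_summands_exist[OF assms g_submodule_supported_on]
    by (elim exE conjE) (rule that)
  have "\<exists>!w. w \<in> (\<Pi>\<^sub>E i\<in>{..<n}. W i) \<and> x = (\<Sum>i<n. w i)" if "x \<in> supported_on X" for x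
  proof (rule ex_ex1I)
    obtain w where w: "\<forall>i<n. w i \<in> W i" "x = (\<Sum>i<n. w i)" using ex \<open>x \<in> _\<close> by blast
    then show "\<exists>w. w \<in> (\<Pi>\<^sub>E i\<in>{..<n}. W i) \<and> x = (\<Sum>i<n. w i)"
      by (intro exI[of _ "restrict w {..<n}"]) auto
  next
    fix w w' assume *: "w \<in> (\<Pi>\<^sub>E i\<in>{..<n}. W i) \<and> x = (\<Sum>i<n. w i)"
      "w' \<in> (\<Pi>\<^sub>E i\<in>{..<n}. W i) \<and> x = (\<Sum>i<n. w' i)"
    have "\<forall>i<n. w i - w' i = 0"
    proof (rule indep[THEN spec, of "\<lambda>i. w i - w' i", THEN mp], rule conjI)
      show "\<forall>i<n. w i - w' i \<in> W i"
        using * W by (auto simp: PiE_iff g_submodule_def fs.subspace_diff)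
      show "(\<Sum>i<n. w i - w' i) = 0" using * by (simp add: sum_subtractf)
    qed
    then show "w = w'" using * by (intro PiE_ext[of w "{..<n}" W w']) auto
  qed
  then show ?thesis unfolding simple_decomposition_iff using W by blast
qed

end

section \<open>Balanced forms and Schur's lemma\<close>

locale basis_simple_pair = right_basis e X
  for e :: "'a::{finite, semigroup_mult}" and X :: "'a set" +
  fixes V :: "('a \<Rightarrow> 'k::alg_closed_field, 'v) module"
  assumes left_module_V: "left_module (group_algebra e) V"
    and simple_V: "simple_module (group_algebra e) V"
begin

abbreviation "A \<equiv> group_algebra e :: ('a \<Rightarrow> 'k) ring"
abbreviation "KH \<equiv> supported_on H :: ('a \<Rightarrow> 'k) set"
abbreviation act (infixr \<open>\<cdot>\<close> 75) where "r \<cdot> v \<equiv> r \<odot>\<^bsub>V\<^esub> v"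

sublocale V: left_module A V
  by (rule left_module_V)

lemma act_closed: "r \<in> KH \<Longrightarrow> v \<in> carrier V \<Longrightarrow> r \<cdot> v \<in> carrier V"
  using V.smult_closed by simp

lemma act_assoc: "r \<in> KH \<Longrightarrow> s \<in> KH \<Longrightarrow> v \<in> carrier V \<Longrightarrow> convolution r s \<cdot> v = r \<cdot> (s \<cdot> v)"
  using V.smult_assoc by simp

lemma act_add_left:
  "r \<in> KH \<Longrightarrow> s \<in> KH \<Longrightarrow> v \<in> carrier V \<Longrightarrow> (r + s) \<cdot> v = (r \<cdot> v) \<oplus>\<^bsub>V\<^esub> (s \<cdot> v)"
  using V.smult_l_distr by simp

lemma act_one: "v \<in> carrier V \<Longrightarrow> single e 1 \<cdot> v = v"
  using V.smult_one by simp

lemma single_mem_KH: "g \<in> H \<Longrightarrow> single g c \<in> KH"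
  by (rule single_mem_supported_on)

lemma add_KH: "r \<in> KH \<Longrightarrow> s \<in> KH \<Longrightarrow> r + s \<in> KH"
  and zero_KH: "0 \<in> KH"
  by (simp_all add: subspace_supported_on fs.subspace_add fs.subspace_0)

lemma act_zero_left: "v \<in> carrier V \<Longrightarrow> 0 \<cdot> v = \<zero>\<^bsub>V\<^esub>"
  using act_add_left[OF zero_KH zero_KH, of v] act_closed[OF zero_KH, of v] by simp

lemma act_minus_one:
  assumes "v \<in> carrier V"
  shows "single e (-1) \<cdot> v = \<ominus>\<^bsub>V\<^esub> v"
proof -
  have "single e (-1) + single e (1::'k) = 0"
    by (auto simp: fun_eq_iff single_apply fun_apply)
  then have "(single e (-1) \<cdot> v) \<oplus>\<^bsub>V\<^esub> v = \<zero>\<^bsub>V\<^esub>"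
    using act_add_left[of "single e (-1)" "single e 1" v] assms
    by (simp add: act_one act_zero_left e_mem single_mem_KH)
  then show ?thesis
    using assms by (simp add: V.M.minus_equality act_closed e_mem single_mem_KH)
qed

text \<open>Negation is the action of \<open>single e (-1)\<close>, so closure under it follows from
  closure under the algebra.\<close>

lemma V_simpleD:
  assumes "W \<subseteq> carrier V" "\<zero>\<^bsub>V\<^esub> \<in> W"
    and "\<And>v w. v \<in> W \<Longrightarrow> w \<in> W \<Longrightarrow> v \<oplus>\<^bsub>V\<^esub> w \<in> W"
    and act: "\<And>r v. r \<in> KH \<Longrightarrow> v \<in> W \<Longrightarrow> r \<cdot> v \<in> W"
  shows "W = {\<zero>\<^bsub>V\<^esub>} \<or> W = carrier V"
proof -
  have inv: "inv\<^bsub>add_monoid V\<^esub> x \<in> W" if "x \<in> W" for x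
    using act[OF single_mem_KH[OF e_mem] that, of "-1"] that assms(1)
    by (simp add: act_minus_one subset_iff flip: a_inv_def)
  have "Module.submodule W A V"
    unfolding Module.submodule_def Module.submodule_axioms_def
  proof (intro conjI allI impI)
    show "subgroup W (add_monoid V)"
      by (rule subgroup.intro) (use assms inv in simp_all)
  qed (use act in simp)
  then show ?thesis using simple_V by (simp add: simple_module_def)
qed

text \<open>Any nonzero vector generates the simple module, so a functional is known from its values
  on the translates of this one.\<close>

definition v0 :: 'v where
  "v0 = (SOME v. v \<in> carrier V \<and> v \<noteq> \<zero>\<^bsub>V\<^esub>)"

lemma v0: "v0 \<in> carrier V" "v0 \<noteq> \<zero>\<^bsub>V\<^esub>"
proof -
  have "\<exists>v. v \<in> carrier V \<and> v \<noteq> \<zero>\<^bsub>V\<^esub>"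
    using simple_V V.M.zero_closed by (auto simp: simple_module_def)
  from someI_ex[OF this] show "v0 \<in> carrier V" "v0 \<noteq> \<zero>\<^bsub>V\<^esub>" by (simp_all add: v0_def)
qed

lemma convolution_KH: "r \<in> KH \<Longrightarrow> s \<in> KH \<Longrightarrow> convolution r s \<in> KH"
  using V.R.m_closed by simp

lemma V_cyclic:
  assumes "v \<in> carrier V"
  obtains r where "r \<in> KH" "v = r \<cdot> v0"
proof -
  let ?W = "(\<lambda>r. r \<cdot> v0) ` KH"
  have "?W = {\<zero>\<^bsub>V\<^esub>} \<or> ?W = carrier V"
  proof (rule V_simpleD)
    show "?W \<subseteq> carrier V" using act_closed v0 by blast
    show "\<zero>\<^bsub>V\<^esub> \<in> ?W" using act_zero_left[OF v0(1)] zero_KH by force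
    show "v \<oplus>\<^bsub>V\<^esub> w \<in> ?W" if vw: "v \<in> ?W" "w \<in> ?W" for v w
    proof -
      obtain r s where "r \<in> KH" "v = r \<cdot> v0" "s \<in> KH" "w = s \<cdot> v0" using vw by blast
      then show ?thesis
        by (intro image_eqI[of _ _ "r + s"]) (simp_all add: act_add_left v0 add_KH)
    qed
    show "r \<cdot> v \<in> ?W" if r: "r \<in> KH" and v: "v \<in> ?W" for r v
    proof -
      obtain s where "s \<in> KH" "v = s \<cdot> v0" using v by blast
      then show ?thesis
        by (intro image_eqI[of _ _ "convolution r s"]) (simp_all add: act_assoc v0 convolution_KH r)
    qed
  qed
  moreover have "v0 \<in> ?W"
    by (intro image_eqI[of _ _ "single e 1"]) (simp_all add: act_one v0 single_mem_KH e_mem)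
  ultimately show thesis using that v0 assms by blast
qed

subsection \<open>The dual module\<close>

text \<open>Extensionality is left out, so that the notion applies to a bilinear form with its first
  argument fixed; membership in the dual adds it. Scalars act through the embedding
  \<open>single e\<close>.\<close>

definition functional :: "('v \<Rightarrow> 'k) \<Rightarrow> bool" where
  "functional \<phi> \<longleftrightarrow> (\<forall>v\<in>carrier V. \<forall>w\<in>carrier V. \<phi> (v \<oplus>\<^bsub>V\<^esub> w) = \<phi> v + \<phi> w) \<and>
    (\<forall>c. \<forall>v\<in>carrier V. \<phi> (single e c \<cdot> v) = c * \<phi> v)"

lemma functional_add:
    "functional \<phi> \<Longrightarrow> v \<in> carrier V \<Longrightarrow> w \<in> carrier V \<Longrightarrow> \<phi> (v \<oplus>\<^bsub>V\<^esub> w) = \<phi> v + \<phi> w"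
  and functional_scale: "functional \<phi> \<Longrightarrow> v \<in> carrier V \<Longrightarrow> \<phi> (single e c \<cdot> v) = c * \<phi> v"
  by (simp_all add: functional_def)

lemma functional_zero: "functional \<phi> \<Longrightarrow> \<phi> \<zero>\<^bsub>V\<^esub> = 0"
  using functional_add[of \<phi> "\<zero>\<^bsub>V\<^esub>" "\<zero>\<^bsub>V\<^esub>"]
  by (metis V.M.r_zero V.M.zero_closed add_cancel_left_right)

lemma functional_expand:
  assumes \<phi>: "functional \<phi>" and r: "r \<in> KH" and v: "v \<in> carrier V"
  shows "\<phi> (r \<cdot> v) = (\<Sum>g\<in>H. r g * \<phi> (single g 1 \<cdot> v))"
proof -
  have *: "(\<Sum>g\<in>S. fscale (r g) (single g 1)) \<in> KH \<and>
      \<phi> ((\<Sum>g\<in>S. fscale (r g) (single g 1)) \<cdot> v) = (\<Sum>g\<in>S. r g * \<phi> (single g 1 \<cdot> v))"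
    if "finite S" "S \<subseteq> H" for S
    using that
  proof (induction S rule: finite_induct)
    case empty
    then show ?case
      using \<phi> v by (simp add: zero_KH act_zero_left functional_zero)
  next
    case (insert g S)
    have g: "g \<in> H" using insert by simp
    \<comment> \<open>Written as a product with an embedded scalar, the term is accessible to the
      module law, which lets the coefficient be pulled out of \<open>\<phi>\<close>.\<close>
    have eq: "fscale (r g) (single g 1) = convolution (single e (r g)) (single g 1)"
      using g by (auto simp: convolution_single e_mult_H fun_eq_iff fun_apply single_apply)
    have mem: "fscale (r g) (single g 1) \<in> KH"
      using g by (simp add: fs.subspace_scale subspace_supported_on single_mem_KH)
    have "\<phi> (fscale (r g) (single g 1) \<cdot> v) = r g * \<phi> (single g 1 \<cdot> v)"
      unfolding eq using g v \<phi>
      by (simp add: act_assoc functional_scale act_closed single_mem_KH e_mem)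
    then show ?case
      using insert mem v \<phi>
      by (simp add: act_add_left functional_add act_closed add_KH)
  qed
  have "r = (\<Sum>g\<in>H. fscale (r g) (single g 1))"
    using r by (intro fun_eq_sum_single) (auto simp: supported_on_def)
  then show ?thesis using *[of H] by simp
qed

abbreviation "DV \<equiv> dual_module (single e) V"

lemma mem_dual_iff: "\<phi> \<in> carrier DV \<longleftrightarrow> functional \<phi> \<and> \<phi> \<in> extensional (carrier V)"
  by (auto simp: dual_module_def LinearCombinations.module_hom_def restrict_scalars_def functional_def)

lemma dual_add: "\<phi> \<oplus>\<^bsub>DV\<^esub> \<psi> = (\<lambda>x\<in>carrier V. \<phi> x + \<psi> x)"
  and dual_smult: "r \<odot>\<^bsub>DV\<^esub> \<phi> = (\<lambda>x\<in>carrier V. \<phi> (r \<cdot> x))"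
  by (simp_all add: dual_module_def)

subsection \<open>Balanced forms\<close>

text \<open>These are the bilinear forms that factor through the tensor product. Homogeneity in the
  second argument comes from the last clause, with \<open>r\<close> an embedded scalar.\<close>

definition balanced :: "('a \<Rightarrow> 'k) set \<Rightarrow> (('a \<Rightarrow> 'k) \<Rightarrow> 'v \<Rightarrow> 'k) \<Rightarrow> bool" where
  "balanced P \<beta> \<longleftrightarrow>
    (\<forall>p\<in>P. \<forall>q\<in>P. \<forall>v\<in>carrier V. \<beta> (p + q) v = \<beta> p v + \<beta> q v) \<and>
    (\<forall>c. \<forall>p\<in>P. \<forall>v\<in>carrier V. \<beta> (fscale c p) v = c * \<beta> p v) \<and>
    (\<forall>p\<in>P. \<forall>v\<in>carrier V. \<forall>w\<in>carrier V. \<beta> p (v \<oplus>\<^bsub>V\<^esub> w) = \<beta> p v + \<beta> p w) \<and>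
    (\<forall>p\<in>P. \<forall>r\<in>KH. \<forall>v\<in>carrier V. \<beta> (convolution p r) v = \<beta> p (r \<cdot> v))"

definition nonzero_form :: "('a \<Rightarrow> 'k) set \<Rightarrow> (('a \<Rightarrow> 'k) \<Rightarrow> 'v \<Rightarrow> 'k) \<Rightarrow> bool" where
  "nonzero_form P \<beta> \<longleftrightarrow> (\<exists>p\<in>P. \<exists>v\<in>carrier V. \<beta> p v \<noteq> 0)"

lemma balanced_subset: "balanced P \<beta> \<Longrightarrow> Q \<subseteq> P \<Longrightarrow> balanced Q \<beta>"
  unfolding balanced_def by blast

context
  fixes P \<beta>
  assumes P: "g_submodule P" and bal: "balanced P \<beta>"
begin

lemma balanced_add_left:
    "p \<in> P \<Longrightarrow> q \<in> P \<Longrightarrow> v \<in> carrier V \<Longrightarrow> \<beta> (p + q) v = \<beta> p v + \<beta> q v"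
  and balanced_scale: "p \<in> P \<Longrightarrow> v \<in> carrier V \<Longrightarrow> \<beta> (fscale c p) v = c * \<beta> p v"
  and balanced_add_right:
    "p \<in> P \<Longrightarrow> v \<in> carrier V \<Longrightarrow> w \<in> carrier V \<Longrightarrow> \<beta> p (v \<oplus>\<^bsub>V\<^esub> w) = \<beta> p v + \<beta> p w"
  and balanced_act: "p \<in> P \<Longrightarrow> r \<in> KH \<Longrightarrow> v \<in> carrier V \<Longrightarrow> \<beta> (convolution p r) v = \<beta> p (r \<cdot> v)"
  using bal by (auto simp: balanced_def)

lemma balanced_functional:
  assumes p: "p \<in> P"
  shows "functional (\<beta> p)"
proof -
  have "\<beta> p (single e c \<cdot> v) = c * \<beta> p v" if v: "v \<in> carrier V" for c v
  proof -
    have "\<beta> p (single e c \<cdot> v) = \<beta> (convolution p (single e c)) v"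
      by (simp add: balanced_act[OF p _ v] single_mem_KH e_mem)
    also have "convolution p (single e c) = fscale c p"
      using p g_submodule_subset[OF P] by (intro convolution_single_e) blast
    finally show ?thesis by (simp add: balanced_scale[OF p v])
  qed
  then show ?thesis using p by (simp add: functional_def balanced_add_right)
qed

lemma balanced_zero_left: "v \<in> carrier V \<Longrightarrow> \<beta> 0 v = 0"
  using balanced_scale[of 0 v 0] fs.subspace_0[OF g_submodule_subspace[OF P]] by simp

lemma balanced_diff:
  assumes "p \<in> P" "q \<in> P" "v \<in> carrier V"
  shows "\<beta> (p - q) v = \<beta> p v - \<beta> q v"
proof -
  have "\<beta> (p + fscale (-1) q) v = \<beta> p v + (-1) * \<beta> q v"
    using assms fs.subspace_scale[OF g_submodule_subspace[OF P]]
    by (simp only: balanced_add_left balanced_scale)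
  then show ?thesis by simp
qed

text \<open>The vectors annihilated by the form make up a submodule of \<open>P\<close>, which is
  proper because the form is nonzero; simplicity of \<open>P\<close> leaves only 0.\<close>

lemma left_radical:
  assumes "g_simple P" "nonzero_form P \<beta>" and p: "p \<in> P" "\<And>v. v \<in> carrier V \<Longrightarrow> \<beta> p v = 0"
  shows "p = 0"
proof -
  let ?Q = "{p \<in> P. \<forall>v\<in>carrier V. \<beta> p v = 0}"
  have sP: "fs.subspace P" by (rule g_submodule_subspace[OF P])
  have "fs.subspace ?Q"
    using sP by (intro fs.subspaceI)
      (auto simp: fs.subspace_0 fs.subspace_add fs.subspace_scale balanced_zero_left
        balanced_add_left balanced_scale)
  moreover have "convolution p (single g 1) \<in> ?Q" if "p \<in> ?Q" "g \<in> H" for p g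
    using that P by (auto simp: g_submodule_def balanced_act single_mem_KH act_closed)
  ultimately have "g_submodule ?Q"
    using g_submodule_subset[OF P] unfolding g_submodule_def by blast
  then have "?Q = {0} \<or> ?Q = P"
    using assms(1) by (auto simp: g_simple_def)
  moreover have "?Q \<noteq> P" using assms(2) by (auto simp: nonzero_form_def)
  ultimately show ?thesis using p by blast
qed

text \<open>The mirror image, now with simplicity of \<open>V\<close>. Balancing moves
  \<open>r\<close> from \<open>V\<close> over to \<open>P\<close>, which is stable under it.\<close>

lemma right_radical:
  assumes "nonzero_form P \<beta>" and v: "v \<in> carrier V" "\<And>p. p \<in> P \<Longrightarrow> \<beta> p v = 0"
  shows "v = \<zero>\<^bsub>V\<^esub>"
proof -
  let ?W = "{v \<in> carrier V. \<forall>p\<in>P. \<beta> p v = 0}"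
  have "?W = {\<zero>\<^bsub>V\<^esub>} \<or> ?W = carrier V"
  proof (rule V_simpleD)
    show "\<zero>\<^bsub>V\<^esub> \<in> ?W"
      using functional_zero balanced_functional by simp
    show "v \<oplus>\<^bsub>V\<^esub> w \<in> ?W" if "v \<in> ?W" "w \<in> ?W" for v w
      using that by (simp add: balanced_add_right)
    show "r \<cdot> v \<in> ?W" if r: "r \<in> KH" and v: "v \<in> ?W" for r v
      using v by (simp add: act_closed r g_submodule_convolution[OF P _ r] flip: balanced_act[OF _ r])
  qed simp
  moreover have "?W \<noteq> carrier V" using assms(1) by (auto simp: nonzero_form_def)
  ultimately show ?thesis using v by blast
qed

text \<open>The form embeds \<open>P\<close> into the dual of \<open>V\<close>. The image separates the points of the
  finite-dimensional space \<open>V\<close>, hence is the whole dual; via the generator \<open>v0\<close> this becomes a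
  statement about functions on \<open>H\<close>.\<close>

lemma balanced_representation:
  assumes nz: "nonzero_form P \<beta>" and \<phi>: "functional \<phi>"
  obtains p where "p \<in> P" "\<And>v. v \<in> carrier V \<Longrightarrow> \<phi> v = \<beta> p v"
proof -
  \<comment> \<open>Coordinates of a functional: its values on the translates \<open>g v0\<close>.
    They determine it, since these translates span \<open>V\<close>; the value 0 outside
    \<open>H\<close> is a filler.\<close>
  define code :: "('v \<Rightarrow> 'k) \<Rightarrow> 'a \<Rightarrow> 'k" where
    "code \<psi> = (\<lambda>g. if g \<in> H then \<psi> (single g 1 \<cdot> v0) else 0)" for \<psi>
  have v0_H: "single g 1 \<cdot> v0 \<in> carrier V" if "g \<in> H" for g
    using that v0 by (simp add: act_closed single_mem_KH)
  have sP: "fs.subspace P" by (rule g_submodule_subspace[OF P])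
  have code_expand: "\<psi> (r \<cdot> v0) = (\<Sum>g\<in>H. r g * code \<psi> g)" if "functional \<psi>" "r \<in> KH" for \<psi> r
    using functional_expand[OF that v0(1)] by (simp add: code_def)
  let ?U = "(\<lambda>p. code (\<beta> p)) ` P"
  have U: "fs.subspace ?U"
  proof (rule fs.subspaceI)
    have "code (\<beta> 0) = 0"
      using v0_H by (auto simp: code_def fun_eq_iff fun_apply balanced_zero_left)
    then show "0 \<in> ?U" using fs.subspace_0[OF sP] by force
  next
    fix u u' assume "u \<in> ?U" "u' \<in> ?U"
    then obtain p q where pq: "p \<in> P" "u = code (\<beta> p)" "q \<in> P" "u' = code (\<beta> q)" by blast
    then have "u + u' = code (\<beta> (p + q))"
      using v0_H by (auto simp: code_def fun_eq_iff fun_apply balanced_add_left)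
    then show "u + u' \<in> ?U" using pq fs.subspace_add[OF sP] by blast
  next
    fix c u assume "u \<in> ?U"
    then obtain p where p: "p \<in> P" "u = code (\<beta> p)" by blast
    then have "fscale c u = code (\<beta> (fscale c p))"
      using v0_H by (auto simp: code_def fun_eq_iff fun_apply balanced_scale)
    then show "fscale c u \<in> ?U" using p fs.subspace_scale[OF sP] by blast
  qed
  have "code \<phi> \<in> ?U"
  proof (rule ccontr)
    assume "code \<phi> \<notin> ?U"
    with U obtain l where l: "Vector_Spaces.linear fscale (*) l" "\<And>u. u \<in> ?U \<Longrightarrow> l u = 0"
        "l (code \<phi>) = 1"
      by (rule fs_separating_functional) blast
    \<comment> \<open>The separating functional \<open>l\<close> becomes evaluation at a vector of
      \<open>V\<close>: with these coefficients,
      \<open>l (code \<psi>) = \<psi> (r \<cdot> v0)\<close>. As \<open>l\<close> kills the image of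
      \<open>P\<close>, the vector \<open>r \<cdot> v0\<close> lies in the right radical and is
      zero, against \<open>l (code \<phi>) = 1\<close>.\<close>
    define r where "r = (\<lambda>g. if g \<in> H then l (single g 1) else 0)"
    have r: "r \<in> KH" by (simp add: r_def supported_on_def)
    have l_code: "l (code \<psi>) = \<psi> (r \<cdot> v0)" if "functional \<psi>" for \<psi>
    proof -
      have "l (code \<psi>) = (\<Sum>g\<in>H. code \<psi> g * l (single g 1))"
        by (rule linear_fun_eq_sum_single[OF l(1)]) (auto simp: code_def)
      also have "\<dots> = (\<Sum>g\<in>H. r g * code \<psi> g)"
        by (rule sum.cong) (simp_all add: r_def)
      finally show ?thesis using code_expand[OF that r] by simp
    qed
    have "r \<cdot> v0 = \<zero>\<^bsub>V\<^esub>"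
    proof (rule right_radical[OF nz])
      fix p assume p: "p \<in> P"
      then show "\<beta> p (r \<cdot> v0) = 0"
        using l(2)[of "code (\<beta> p)"] l_code[OF balanced_functional[OF p]] by simp
    qed (simp add: act_closed r v0)
    then show False using l_code[OF \<phi>] l(3) functional_zero[OF \<phi>] by simp
  qed
  then obtain p where p: "p \<in> P" "code \<phi> = code (\<beta> p)" by blast
  have "\<phi> v = \<beta> p v" if "v \<in> carrier V" for v
  proof -
    obtain r where r: "r \<in> KH" "v = r \<cdot> v0" using \<open>v \<in> carrier V\<close> by (rule V_cyclic)
    then show ?thesis
      using code_expand[OF \<phi> r(1)] code_expand[OF balanced_functional[OF p(1)] r(1)] p(2) by simp
  qed
  with p(1) show thesis by (rule that)
qed

text \<open>The map sends \<open>p\<close> to the functional \<open>\<beta> p\<close>. Balancing is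
  its linearity over the group algebra for the right action on the dual; the left radical gives
  injectivity and \<open>balanced_representation\<close> surjectivity.\<close>

lemma isomorphic_if_nonzero_form:
  assumes "g_simple P" "nonzero_form P \<beta>"
  shows "module_isomorphic A (basis_module X\<lparr>carrier := P\<rparr>) DV"
proof -
  define f where "f p = restrict (\<beta> p) (carrier V)" for p
  have f_dual: "f p \<in> carrier DV" if "p \<in> P" for p
    using balanced_functional[OF that] act_closed[OF single_mem_KH[OF e_mem]]
    by (simp add: mem_dual_iff f_def functional_def)
  have "f \<in> LinearCombinations.module_hom A (basis_module X\<lparr>carrier := P\<rparr>) DV"
    unfolding LinearCombinations.module_hom_def
  proof (intro CollectI conjI allI impI)
    fix r m assume "r \<in> carrier A \<and> m \<in> carrier (basis_module X\<lparr>carrier := P\<rparr>)"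
    then show "f (r \<odot>\<^bsub>basis_module X\<lparr>carrier := P\<rparr>\<^esub> m) = r \<odot>\<^bsub>DV\<^esub> f m"
      by (auto simp: f_def dual_smult fun_eq_iff balanced_act act_closed)
  qed (use f_dual in \<open>auto simp: f_def dual_add fun_eq_iff balanced_add_left\<close>)
  moreover have "bij_betw f P (carrier DV)"
    unfolding bij_betw_def
  proof (intro conjI equalityI subsetI inj_onI)
    fix p q assume pq: "p \<in> P" "q \<in> P" "f p = f q"
    have "\<beta> p v = \<beta> q v" if "v \<in> carrier V" for v
      using fun_cong[OF pq(3), of v] that by (simp add: f_def)
    then have "p - q = 0"
      using pq fs.subspace_diff[OF g_submodule_subspace[OF P]]
      by (intro left_radical[OF assms]) (simp_all add: balanced_diff)
    then show "p = q" by simp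
  next
    fix \<phi> assume "\<phi> \<in> carrier DV"
    then have \<phi>: "functional \<phi>" "\<phi> \<in> extensional (carrier V)" by (simp_all add: mem_dual_iff)
    obtain p where p: "p \<in> P" "\<And>v. v \<in> carrier V \<Longrightarrow> \<phi> v = \<beta> p v"
      using balanced_representation[OF assms(2) \<phi>(1)] by blast
    have "\<phi> = f p" using p(2) \<phi>(2) by (intro extensionalityI[of _ "carrier V"]) (auto simp: f_def)
    with p(1) show "\<phi> \<in> f ` P" by blast
  qed (use f_dual in auto)
  ultimately show ?thesis by (auto simp: module_isomorphic_def)
qed

end

text \<open>The isomorphism itself is the form, with \<open>f p v\<close> as its value at
  \<open>p\<close> and \<open>v\<close>. If that form were zero, \<open>f\<close> would be constant,
  which injectivity excludes on a nonzero \<open>P\<close>.\<close>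

lemma nonzero_form_if_isomorphic:
  assumes P: "g_submodule P" and simple: "g_simple P"
    and iso: "module_isomorphic A (basis_module X\<lparr>carrier := P\<rparr>) DV"
  obtains \<beta> where "balanced P \<beta>" "nonzero_form P \<beta>"
proof -
  obtain f where f: "f \<in> LinearCombinations.module_hom A (basis_module X\<lparr>carrier := P\<rparr>) DV"
      "bij_betw f P (carrier DV)"
    using iso by (auto simp: module_isomorphic_def)
  have mem: "f p \<in> carrier DV" if "p \<in> P" for p
    using f(2) that by (auto simp: bij_betw_def)
  have add: "f (p + q) = (\<lambda>x\<in>carrier V. f p x + f q x)" if "p \<in> P" "q \<in> P" for p q
    using LinearCombinations.module_hom_add[OF f(1), of p q] that by (simp add: dual_add)
  have smult: "f (convolution p r) = (\<lambda>x\<in>carrier V. f p (r \<cdot> x))" if "p \<in> P" "r \<in> KH" for p r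
    using LinearCombinations.module_hom_smult[OF f(1), of r p] that by (simp add: dual_smult)
  have "balanced P f"
    unfolding balanced_def
  proof (intro conjI ballI allI)
    fix c p v assume p: "p \<in> P" and v: "v \<in> carrier V"
    have "fscale c p = convolution p (single e c)"
      using p g_submodule_subset[OF P] by (intro convolution_single_e[symmetric]) blast
    then show "f (fscale c p) v = c * f p v"
      using smult[OF p single_mem_KH[OF e_mem]] mem[OF p] v
      by (simp add: mem_dual_iff functional_def)
  next
    fix p v w assume "p \<in> P" "v \<in> carrier V" "w \<in> carrier V"
    then show "f p (v \<oplus>\<^bsub>V\<^esub> w) = f p v + f p w"
      using mem by (simp add: mem_dual_iff functional_add)
  qed (simp_all add: add smult)
  moreover have "nonzero_form P f"
  proof (rule ccontr)
    assume zero: "\<not> nonzero_form P f"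
    have "f p = (\<lambda>x\<in>carrier V. 0)" if "p \<in> P" for p
      using mem[OF that] zero that
      by (intro extensionalityI[of _ "carrier V"]) (auto simp: mem_dual_iff nonzero_form_def)
    then have const: "f p = f 0" if "p \<in> P" for p
      using that fs.subspace_0[OF g_submodule_subspace[OF P]] by (simp only:)
    have "p = 0" if "p \<in> P" for p
      using inj_onD[OF bij_betw_imp_inj_on[OF f(2)] const[OF that] that]
        fs.subspace_0[OF g_submodule_subspace[OF P]] by blast
    then have "P = {0}" using fs.subspace_0[OF g_submodule_subspace[OF P]] by blast
    with simple show False by (simp add: g_simple_def)
  qed
  ultimately show thesis by (rule that)
qed

text \<open>Nondegeneracy of \<open>\<beta>\<close> gives \<open>\<beta>' p = \<beta> (T p)\<close>
  on \<open>V\<close> for a linear map \<open>T\<close> of \<open>P\<close>. If \<open>u\<close> is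
  an eigenvector of \<open>T\<close> with eigenvalue \<open>c\<close>, the balanced form
  \<open>\<beta>' - c \<beta>\<close> has \<open>u\<close> in its left radical, hence
  vanishes.\<close>

lemma balanced_proportional:
  assumes P: "g_submodule P" and simple: "g_simple P"
    and \<beta>: "balanced P \<beta>" "nonzero_form P \<beta>" and \<beta>': "balanced P \<beta>'"
  obtains c where "\<And>p v. p \<in> P \<Longrightarrow> v \<in> carrier V \<Longrightarrow> \<beta>' p v = c * \<beta> p v"
proof -
  have sP: "fs.subspace P" by (rule g_submodule_subspace[OF P])
  define T where "T p = (SOME q. q \<in> P \<and> (\<forall>v\<in>carrier V. \<beta>' p v = \<beta> q v))" for p
  have T_spec: "T p \<in> P \<and> (\<forall>v\<in>carrier V. \<beta>' p v = \<beta> (T p) v)" if p: "p \<in> P" for p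
  proof -
    obtain q where "q \<in> P" "\<And>v. v \<in> carrier V \<Longrightarrow> \<beta>' p v = \<beta> q v"
      by (rule balanced_representation[OF P \<beta> balanced_functional[OF P \<beta>' p]]) (rule that)
    then have "\<exists>q. q \<in> P \<and> (\<forall>v\<in>carrier V. \<beta>' p v = \<beta> q v)" by blast
    then show ?thesis unfolding T_def by (rule someI_ex)
  qed
  have T: "\<And>p. p \<in> P \<Longrightarrow> T p \<in> P"
      "\<And>p v. p \<in> P \<Longrightarrow> v \<in> carrier V \<Longrightarrow> \<beta>' p v = \<beta> (T p) v"
    using T_spec by simp_all
  \<comment> \<open>A vector of \<open>P\<close> is determined by the functional it represents; this
    turns the defining property of the chosen \<open>T\<close> into linearity.\<close>
  have eqI: "p = q" if "p \<in> P" "q \<in> P" "\<And>v. v \<in> carrier V \<Longrightarrow> \<beta> p v = \<beta> q v" for p q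
  proof -
    have "p - q = 0"
      using that fs.subspace_diff[OF sP]
      by (intro left_radical[OF P \<beta>(1) simple \<beta>(2)]) (simp_all add: balanced_diff[OF P \<beta>(1)])
    then show ?thesis by simp
  qed
  note cl = fs.subspace_add[OF sP] fs.subspace_scale[OF sP]
  interpret T: fs_endomorphism P T
  proof
    show "T (v + w) = T v + T w" if "v \<in> P" "w \<in> P" for v w
      using that by (intro eqI) (simp_all add: cl T(1) balanced_add_left[OF P \<beta>(1)]
          balanced_add_left[OF P \<beta>'] flip: T(2))
    show "T (fscale c w) = fscale c (T w)" if "w \<in> P" for w c
      using that by (intro eqI) (simp_all add: cl T(1) balanced_scale[OF P \<beta>(1)]
          balanced_scale[OF P \<beta>'] flip: T(2))
  qed (use sP T in auto)
  obtain c u where u: "u \<in> P" "u \<noteq> 0" "T u = fscale c u"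
    using T.eigenvector_exists simple by (auto simp: g_simple_def)
  let ?\<gamma> = "\<lambda>p v. \<beta>' p v - c * \<beta> p v"
  have \<gamma>: "balanced P ?\<gamma>"
    unfolding balanced_def
    by (intro conjI ballI allI; simp only: balanced_add_left[OF P \<beta>(1)] balanced_add_left[OF P \<beta>']
        balanced_scale[OF P \<beta>(1)] balanced_scale[OF P \<beta>'] balanced_add_right[OF P \<beta>(1)]
        balanced_add_right[OF P \<beta>'] balanced_act[OF P \<beta>(1)] balanced_act[OF P \<beta>'];
        simp add: ring_distribs)
  have "\<not> nonzero_form P ?\<gamma>"
  proof
    assume "nonzero_form P ?\<gamma>"
    then have "u = 0"
      using u(1) by (intro left_radical[OF P \<gamma> simple])
        (simp_all add: T(2) u(3) balanced_scale[OF P \<beta>(1)])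
    with u(2) show False by simp
  qed
  then show thesis by (intro that[of c]) (auto simp: nonzero_form_def)
qed

end

section \<open>The tensor product\<close>

lemma free_space_sel [simp]:
  "carrier (free_space S) = {f. finite {x. f x \<noteq> 0} \<and> {x. f x \<noteq> 0} \<subseteq> S}"
  "zero (free_space S) = 0" "add (free_space S) = (+)" "module.smult (free_space S) = fscale"
  by (simp_all add: free_space_def fun_eq_iff fun_apply)

lemma subspace_free_space: "fs.subspace (carrier (free_space S :: ('k::field, 'x \<Rightarrow> 'k) module))"
proof (rule fs.subspaceI)
  fix f g :: "'x \<Rightarrow> 'k" and c
  assume f: "f \<in> carrier (free_space S)"
  show "fscale c f \<in> carrier (free_space S)"
    using f by (auto simp: fun_apply elim: finite_subset[rotated])
  assume g: "g \<in> carrier (free_space S)"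
  have "{x. (f + g) x \<noteq> 0} \<subseteq> {x. f x \<noteq> 0} \<union> {x. g x \<noteq> 0}"
    by (auto simp: fun_apply)
  then show "f + g \<in> carrier (free_space S)"
    using f g by (auto intro: finite_subset)
qed (simp add: fun_apply)

lemma free_space_vectorspace: "vectorspace class_ring (free_space S :: ('k::field, 'x \<Rightarrow> 'k) module)"
proof -
  have sub: "fs.subspace (carrier (free_space S :: ('k, 'x \<Rightarrow> 'k) module))"
    by (rule subspace_free_space)
  show ?thesis
  proof (rule vs_criteria)
    show "\<forall>v\<in>carrier (free_space S). \<exists>w\<in>carrier (free_space S).
        v \<oplus>\<^bsub>free_space S\<^esub> w = \<zero>\<^bsub>free_space S :: ('k, 'x \<Rightarrow> 'k) module\<^esub>"
    proof
      fix v :: "'x \<Rightarrow> 'k" assume "v \<in> carrier (free_space S)"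
      then show "\<exists>w\<in>carrier (free_space S). v \<oplus>\<^bsub>free_space S\<^esub> w = \<zero>\<^bsub>free_space S\<^esub>"
        using fs.subspace_neg[OF sub] by (intro bexI[of _ "- v"]) simp_all
    qed
  qed (use sub in \<open>simp_all del: free_space_sel(1) add: class_field fs.subspace_0 fs.subspace_add
      fs.subspace_scale fs.scale_left_distrib fs.scale_right_distrib add_ac\<close>)
qed

lemma single_mem_free_space: "z \<in> S \<Longrightarrow> single z c \<in> carrier (free_space S)"
  by (auto simp: single_apply)

text \<open>On finitely supported functions, the linear functional with value
  \<open>\<Phi> z\<close> at the basis vector of \<open>z\<close>.\<close>

definition free_extension :: "('x \<Rightarrow> 'k::field) \<Rightarrow> ('x \<Rightarrow> 'k) \<Rightarrow> 'k" where
  "free_extension \<Phi> f = (\<Sum>z | f z \<noteq> 0. f z * \<Phi> z)"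

lemma free_extension_eq:
  assumes "finite S" "{z. f z \<noteq> 0} \<subseteq> S"
  shows "free_extension \<Phi> f = (\<Sum>z\<in>S. f z * \<Phi> z)"
  unfolding free_extension_def by (rule sum.mono_neutral_left) (use assms in auto)

lemma free_extension_single: "free_extension \<Phi> (single z c) = c * \<Phi> z"
  by (subst free_extension_eq[of "{z}"]) (auto simp: single_apply)

lemma free_extension_hom:
  "free_extension \<Phi> \<in> LinearCombinations.module_hom class_ring
    (free_space S :: ('k::field, 'x \<Rightarrow> 'k) module) field_module"
  unfolding LinearCombinations.module_hom_def
proof (intro CollectI conjI allI impI)
  fix f g :: "'x \<Rightarrow> 'k" assume fg: "f \<in> carrier (free_space S) \<and> g \<in> carrier (free_space S)"
  let ?S = "{z. f z \<noteq> 0} \<union> {z. g z \<noteq> 0}"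
  have fin: "finite ?S" using fg by simp
  have "free_extension \<Phi> (f + g) = (\<Sum>z\<in>?S. (f + g) z * \<Phi> z)"
    by (rule free_extension_eq[OF fin]) (auto simp: fun_apply)
  also have "\<dots> = (\<Sum>z\<in>?S. f z * \<Phi> z) + (\<Sum>z\<in>?S. g z * \<Phi> z)"
    by (simp only: fun_apply distrib_right sum.distrib)
  also have "\<dots> = free_extension \<Phi> f + free_extension \<Phi> g"
    using free_extension_eq[OF fin, of f] free_extension_eq[OF fin, of g] by simp
  finally show "free_extension \<Phi> (f \<oplus>\<^bsub>free_space S\<^esub> g) =
      free_extension \<Phi> f \<oplus>\<^bsub>field_module\<^esub> free_extension \<Phi> g" by simp
next
  fix c :: 'k and f :: "'x \<Rightarrow> 'k" assume f: "c \<in> carrier class_ring \<and> f \<in> carrier (free_space S)"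
  then have "free_extension \<Phi> (fscale c f) = (\<Sum>z | f z \<noteq> 0. fscale c f z * \<Phi> z)"
    by (intro free_extension_eq) (auto simp: fun_apply)
  also have "\<dots> = c * free_extension \<Phi> f"
    by (simp only: fun_apply free_extension_def sum_distrib_left mult.assoc)
  finally show "free_extension \<Phi> (c \<odot>\<^bsub>free_space S\<^esub> f) = c \<odot>\<^bsub>field_module\<^esub> free_extension \<Phi> f"
    by simp
qed simp

text \<open>Being a submodule, this kernel can serve as an upper bound for the span of the tensor
  relations.\<close>

lemma free_extension_kernel:
  "LinearCombinations.submodule class_ring {f \<in> carrier (free_space S). free_extension \<Phi> f = 0}
    (free_space S :: ('k::field, 'x \<Rightarrow> 'k) module)"
proof -
  interpret mod_hom class_ring "free_space S :: ('k, 'x \<Rightarrow> 'k) module" field_module "free_extension \<Phi>"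
    by (intro mod_hom.intro mod_hom_axioms.intro free_extension_hom
        vectorspace.axioms(1)[OF free_space_vectorspace] vectorspace.axioms(1)[OF field_module_vectorspace])
  show ?thesis using ker_is_submodule unfolding ker_def by simp
qed

context basis_simple_pair
begin

abbreviation "M \<equiv> basis_module X :: ('a \<Rightarrow> 'k, 'a \<Rightarrow> 'k) module"
abbreviation "F \<equiv> free_space (supported_on X \<times> carrier V) :: ('k, ('a \<Rightarrow> 'k) \<times> 'v \<Rightarrow> 'k) module"
abbreviation "relations \<equiv> tensor_relations (single e) A M V"
abbreviation "N \<equiv> LinearCombinations.module.span class_ring F relations"

text \<open>Restates the generators with the operations of the function space; in the last family
  the action of an embedded scalar turns into \<open>fscale\<close>.\<close>

lemma relation_cases:
  assumes "\<rho> \<in> relations"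
  obtains
    (add_left) x x' y where "x \<in> supported_on X" "x' \<in> supported_on X" "y \<in> carrier V"
      "\<rho> = single (x + x', y) 1 - single (x, y) 1 - single (x', y) 1"
  | (add_right) x y y' where "x \<in> supported_on X" "y \<in> carrier V" "y' \<in> carrier V"
      "\<rho> = single (x, y \<oplus>\<^bsub>V\<^esub> y') 1 - single (x, y) 1 - single (x, y') 1"
  | (act) r x y where "r \<in> KH" "x \<in> supported_on X" "y \<in> carrier V"
      "\<rho> = single (convolution x r, y) 1 - single (x, r \<cdot> y) 1"
  | (scale) c x y where "x \<in> supported_on X" "y \<in> carrier V"
      "\<rho> = single (fscale c x, y) 1 - fscale c (single (x, y) 1)"
proof -
  note [simp] = fun_diff_def fscale_def
  consider
      x x' y where "x \<in> supported_on X" "x' \<in> supported_on X" "y \<in> carrier V"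
        "\<rho> = (\<lambda>z. single (x + x', y) 1 z - single (x, y) 1 z - single (x', y) 1 z)"
    | x y y' where "x \<in> supported_on X" "y \<in> carrier V" "y' \<in> carrier V"
        "\<rho> = (\<lambda>z. single (x, y \<oplus>\<^bsub>V\<^esub> y') 1 z - single (x, y) 1 z - single (x, y') 1 z)"
    | r x y where "r \<in> KH" "x \<in> supported_on X" "y \<in> carrier V"
        "\<rho> = (\<lambda>z. single (convolution x r, y) 1 z - single (x, r \<cdot> y) 1 z)"
    | c x y where "x \<in> supported_on X" "y \<in> carrier V"
        "\<rho> = (\<lambda>z. single (convolution x (single e c), y) 1 z - c * single (x, y) 1 z)"
    using assms unfolding tensor_relations_def Un_iff mem_Collect_eq basis_module_sel group_algebra_sel
    by (elim disjE exE conjE) (rule that; assumption)+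
  then show thesis
  proof cases
    case 1
    then show ?thesis by (intro add_left[of x x' y]) simp_all
  next
    case 2
    then show ?thesis by (intro add_right[of x y y']) simp_all
  next
    case 3
    then show ?thesis by (intro act[of r x y]) simp_all
  next
    case 4
    then show ?thesis by (intro scale[of x y c]) (simp_all add: convolution_single_e)
  qed
qed

lemma relation_add_left:
    "x \<in> supported_on X \<Longrightarrow> x' \<in> supported_on X \<Longrightarrow> y \<in> carrier V \<Longrightarrow>
      single (x + x', y) 1 - single (x, y) 1 - single (x', y) 1 \<in> relations"
  and relation_add_right:
    "x \<in> supported_on X \<Longrightarrow> y \<in> carrier V \<Longrightarrow> y' \<in> carrier V \<Longrightarrow>
      single (x, y \<oplus>\<^bsub>V\<^esub> y') 1 - single (x, y) 1 - single (x, y') 1 \<in> relations"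
  and relation_act:
    "r \<in> KH \<Longrightarrow> x \<in> supported_on X \<Longrightarrow> y \<in> carrier V \<Longrightarrow>
      single (convolution x r, y) 1 - single (x, r \<cdot> y) 1 \<in> relations"
  and relation_scale:
    "x \<in> supported_on X \<Longrightarrow> y \<in> carrier V \<Longrightarrow>
      single (fscale c x, y) 1 - fscale c (single (x, y) 1) \<in> relations"
proof -
  assume x: "x \<in> supported_on X"
  then have eq: "fscale c x = convolution x (single e c)" by (simp add: convolution_single_e)
  note defs = tensor_relations_def basis_module_sel group_algebra_sel fun_diff_def
    fscale_def[of c "single _ _"]
  { assume "x' \<in> supported_on X" "y \<in> carrier V"
    with x show "single (x + x', y) 1 - single (x, y) 1 - single (x', y) 1 \<in> relations"
      unfolding defs by blast }
  { assume "y \<in> carrier V" "y' \<in> carrier V"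
    with x show "single (x, y \<oplus>\<^bsub>V\<^esub> y') 1 - single (x, y) 1 - single (x, y') 1 \<in> relations"
      unfolding defs by blast }
  { assume "r \<in> KH" "y \<in> carrier V"
    with x show "single (convolution x r, y) 1 - single (x, r \<cdot> y) 1 \<in> relations"
      unfolding defs by blast }
  { assume "y \<in> carrier V"
    with x show "single (fscale c x, y) 1 - fscale c (single (x, y) 1) \<in> relations"
      unfolding eq defs by blast }
qed

lemma supported_on_closed:
    "x \<in> supported_on X \<Longrightarrow> y \<in> supported_on X \<Longrightarrow> x + y \<in> supported_on X"
    "x \<in> supported_on X \<Longrightarrow> fscale c x \<in> supported_on X"
  by (simp_all add: fs.subspace_add fs.subspace_scale subspace_supported_on)

lemma free_extension_diff:
  assumes "f \<in> carrier F" "g \<in> carrier F"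
  shows "free_extension \<Phi> (f - g) = free_extension \<Phi> f - free_extension \<Phi> g" "f - g \<in> carrier F"
proof -
  have g: "fscale (-1) g \<in> carrier F"
    using fs.subspace_scale[OF subspace_free_space assms(2)] .
  have "free_extension \<Phi> (fscale (-1) g) = - free_extension \<Phi> g"
    using LinearCombinations.module_hom_smult[OF free_extension_hom _ assms(2), of "-1"] by simp
  then show "free_extension \<Phi> (f - g) = free_extension \<Phi> f - free_extension \<Phi> g"
    using LinearCombinations.module_hom_add[OF free_extension_hom assms(1) g] by simp
  show "f - g \<in> carrier F"
    using fs.subspace_diff[OF subspace_free_space assms] .
qed

lemma single_mem_F: "x \<in> supported_on X \<Longrightarrow> y \<in> carrier V \<Longrightarrow> single (x, y) c \<in> carrier F"
  by (rule single_mem_free_space) simp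

lemma relations_subset: "relations \<subseteq> carrier F"
proof
  fix \<rho> assume "\<rho> \<in> relations"
  then show "\<rho> \<in> carrier F"
    by (cases rule: relation_cases)
      (simp_all only: free_extension_diff(2) single_mem_F supported_on_closed V.M.a_closed
        act_closed convolution_supported fs.subspace_scale[OF subspace_free_space])
qed

lemma N_submodule: "LinearCombinations.submodule class_ring N F"
  and relations_N: "relations \<subseteq> N"
  and N_minimal: "LinearCombinations.submodule class_ring U F \<Longrightarrow> relations \<subseteq> U \<Longrightarrow> N \<subseteq> U"
proof -
  interpret F: vectorspace class_ring F by (rule free_space_vectorspace)
  show "LinearCombinations.submodule class_ring N F"
    by (rule F.span_is_submodule[OF relations_subset])
  show "relations \<subseteq> N" by (rule F.in_own_span[OF relations_subset])
  show "N \<subseteq> U" if "LinearCombinations.submodule class_ring U F" "relations \<subseteq> U"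
    by (rule F.span_is_subset[OF that(2,1)])
qed

lemma N_subspace: "fs.subspace N"
  using N_submodule by (intro fs.subspaceI) (simp_all add: LinearCombinations.submodule_def)

text \<open>One direction of the universal property: the linear extension of a balanced form kills
  every generator, so its kernel contains their span.\<close>

lemma free_extension_balanced:
  assumes bal: "balanced (supported_on X) \<beta>" and x: "x \<in> N"
  shows "free_extension (\<lambda>z. \<beta> (fst z) (snd z)) x = 0"
proof -
  let ?\<Phi> = "\<lambda>z. \<beta> (fst z) (snd z)"
  note b = balanced_add_left[OF g_submodule_supported_on bal] balanced_scale[OF g_submodule_supported_on bal]
    balanced_add_right[OF g_submodule_supported_on bal] balanced_act[OF g_submodule_supported_on bal]
  have scale: "free_extension ?\<Phi> (fscale c (single (x, y) 1)) = c * \<beta> x y"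
    if "x \<in> supported_on X" "y \<in> carrier V" for c x y
    using LinearCombinations.module_hom_smult[OF free_extension_hom _ single_mem_F[OF that], of c ?\<Phi> 1]
    by (simp add: free_extension_single)
  have "free_extension ?\<Phi> \<rho> = 0" if "\<rho> \<in> relations" for \<rho>
    using that
    by (cases rule: relation_cases)
      (simp_all only: free_extension_diff single_mem_F supported_on_closed V.M.a_closed
        act_closed convolution_supported fs.subspace_scale[OF subspace_free_space]
        free_extension_single fst_conv snd_conv b scale mult_1 add_diff_cancel_left'
        diff_self)
  then have "relations \<subseteq> {f \<in> carrier F. free_extension ?\<Phi> f = 0}"
    using relations_subset by blast
  then have "N \<subseteq> {f \<in> carrier F. free_extension ?\<Phi> f = 0}"
    by (rule N_minimal[OF free_extension_kernel])
  with x show ?thesis by blast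
qed

text \<open>The converse direction: each family of generators, sent to zero by \<open>l\<close>,
  yields one clause of balancedness.\<close>

lemma balanced_of_functional:
  assumes l: "Vector_Spaces.linear fscale (*) l" and N: "\<And>x. x \<in> N \<Longrightarrow> l x = (0::'k)"
  shows "balanced (supported_on X) (\<lambda>x y. l (single (x, y) 1))"
proof -
  note zero = subsetD[OF relations_N, THEN N]
  note d = fs_dual.linear_diff[OF l] fs_dual.linear_add[OF l] fs_dual.linear_scale[OF l]
  show ?thesis
    unfolding balanced_def
  proof (intro conjI ballI allI)
    fix p q :: "'a \<Rightarrow> 'k" and v assume "p \<in> supported_on X" "q \<in> supported_on X" "v \<in> carrier V"
    from zero[OF relation_add_left[OF this]]
    show "l (single (p + q, v) 1) = l (single (p, v) 1) + l (single (q, v) 1)"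
      by (simp only: d diff_diff_eq right_minus_eq)
  next
    fix c and p :: "'a \<Rightarrow> 'k" and v assume "p \<in> supported_on X" "v \<in> carrier V"
    from zero[OF relation_scale[OF this]]
    show "l (single (fscale c p, v) 1) = c * l (single (p, v) 1)"
      by (simp only: d right_minus_eq)
  next
    fix p :: "'a \<Rightarrow> 'k" and v w assume "p \<in> supported_on X" "v \<in> carrier V" "w \<in> carrier V"
    from zero[OF relation_add_right[OF this]]
    show "l (single (p, v \<oplus>\<^bsub>V\<^esub> w) 1) = l (single (p, v) 1) + l (single (p, w) 1)"
      by (simp only: d diff_diff_eq right_minus_eq)
  next
    fix p r :: "'a \<Rightarrow> 'k" and v assume "p \<in> supported_on X" "r \<in> KH" "v \<in> carrier V"
    from zero[OF relation_act[OF this(2,1,3)]]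
    show "l (single (convolution p r, v) 1) = l (single (p, r \<cdot> v) 1)"
      by (simp only: d right_minus_eq)
  qed
qed

lemma functional_expand_F:
  fixes l :: "(('a \<Rightarrow> 'k) \<times> 'v \<Rightarrow> 'k) \<Rightarrow> 'k"
  assumes l: "Vector_Spaces.linear fscale (*) l" and x: "x \<in> carrier F"
  shows "l x = free_extension (\<lambda>z. l (single (fst z, snd z) 1)) x"
  unfolding free_extension_def prod.collapse
  by (rule linear_fun_eq_sum_single[OF l]) (use x in auto)

section \<open>Components with respect to a decomposition into simple summands\<close>

context
  fixes n :: nat and W :: "nat \<Rightarrow> ('a \<Rightarrow> 'k) set"
  assumes dec: "simple_decomposition A M n W"
begin

lemma W_submodule: "i < n \<Longrightarrow> g_submodule (W i)"
  and W_simple: "i < n \<Longrightarrow> g_simple (W i)"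
  and unique_components:
    "x \<in> supported_on X \<Longrightarrow> \<exists>!w. w \<in> (\<Pi>\<^sub>E i\<in>{..<n}. W i) \<and> x = (\<Sum>i<n. w i)"
  using dec unfolding simple_decomposition_iff by blast+

lemmas W_subspace = g_submodule_subspace[OF W_submodule]
lemmas W_subset = g_submodule_subset[OF W_submodule]

definition component :: "('a \<Rightarrow> 'k) \<Rightarrow> nat \<Rightarrow> 'a \<Rightarrow> 'k" where
  "component x = (THE w. w \<in> (\<Pi>\<^sub>E i\<in>{..<n}. W i) \<and> x = (\<Sum>i<n. w i))"

lemma component_mem: "x \<in> supported_on X \<Longrightarrow> i < n \<Longrightarrow> component x i \<in> W i"
  and sum_component: "x \<in> supported_on X \<Longrightarrow> (\<Sum>i<n. component x i) = x"
proof -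
  assume "x \<in> supported_on X"
  from theI'[OF unique_components[OF this]]
  have *: "component x \<in> (\<Pi>\<^sub>E i\<in>{..<n}. W i)" "x = (\<Sum>i<n. component x i)"
    unfolding component_def by blast+
  show "(\<Sum>i<n. component x i) = x" by (rule *(2)[symmetric])
  show "component x i \<in> W i" if "i < n" using PiE_mem[OF *(1), of i] that by simp
qed

text \<open>Through this form of uniqueness, properties of components are obtained by naming a
  family in the summands with the right sum. Restriction to \<open>{..<n}\<close> makes families
  comparable in the extensional product.\<close>

lemma component_eqI:
  assumes "\<And>i. i < n \<Longrightarrow> w i \<in> W i" and i: "i < n"
  shows "component (\<Sum>i<n. w i) i = w i"
proof -
  let ?x = "\<Sum>i<n. w i"
  have x: "?x \<in> supported_on X"
    using assms(1) W_subset by (intro fs.subspace_sum[OF subspace_supported_on]) blast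
  have "restrict (component ?x) {..<n} \<in> (\<Pi>\<^sub>E i\<in>{..<n}. W i) \<and>
      ?x = (\<Sum>i<n. restrict (component ?x) {..<n} i)"
    using component_mem[OF x] sum_component[OF x] by simp
  moreover have "restrict w {..<n} \<in> (\<Pi>\<^sub>E i\<in>{..<n}. W i) \<and> ?x = (\<Sum>i<n. restrict w {..<n} i)"
    using assms(1) by simp
  ultimately have "restrict (component ?x) {..<n} = restrict w {..<n}"
    using unique_components[OF x] by blast
  from fun_cong[OF this, of i] i show ?thesis by simp
qed

lemma component_add:
  assumes "x \<in> supported_on X" "y \<in> supported_on X" "i < n"
  shows "component (x + y) i = component x i + component y i"
proof -
  have "component (\<Sum>i<n. component x i + component y i) i = component x i + component y i"
    by (rule component_eqI) (use assms component_mem W_subspace fs.subspace_add in blast)+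
  then show ?thesis by (simp only: sum.distrib sum_component[OF assms(1)] sum_component[OF assms(2)])
qed

lemma component_scale:
  assumes "x \<in> supported_on X" "i < n"
  shows "component (fscale c x) i = fscale c (component x i)"
proof -
  have "component (\<Sum>i<n. fscale c (component x i)) i = fscale c (component x i)"
    by (rule component_eqI) (use assms component_mem W_subspace fs.subspace_scale in blast)+
  then show ?thesis by (simp only: sum_component[OF assms(1)] flip: fs.scale_sum_right)
qed

lemma component_convolution:
  assumes "x \<in> supported_on X" "r \<in> KH" "i < n"
  shows "component (convolution x r) i = convolution (component x i) r"
proof -
  have "component (\<Sum>i<n. convolution (component x i) r) i = convolution (component x i) r"
    by (rule component_eqI) (use assms component_mem W_submodule g_submodule_convolution in blast)+
  then show ?thesis by (simp only: sum_component[OF assms(1)] flip: convolution_sum_left)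
qed

lemma component_of_summand:
  assumes x: "x \<in> W j" and "j < n" "i < n"
  shows "component x i = (if i = j then x else 0)"
proof -
  have "component (\<Sum>i<n. if i = j then x else 0) i = (if i = j then x else 0)"
    by (rule component_eqI) (use assms W_subspace fs.subspace_0 in auto)
  moreover have "(\<Sum>i<n. if i = j then x else 0) = x"
    using assms(2) by (subst sum.delta) auto
  ultimately show ?thesis by (simp only:)
qed

text \<open>The form is pulled back along the projection onto \<open>W i\<close>, which commutes
  with the action of the group algebra.\<close>

lemma balanced_component:
  assumes \<beta>: "balanced (W i) \<beta>" and i: "i < n"
  shows "balanced (supported_on X) (\<lambda>x. \<beta> (component x i))"
proof -
  note b = balanced_add_left[OF W_submodule[OF i] \<beta>] balanced_scale[OF W_submodule[OF i] \<beta>]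
    balanced_add_right[OF W_submodule[OF i] \<beta>] balanced_act[OF W_submodule[OF i] \<beta>]
  show ?thesis
    unfolding balanced_def
    by (intro conjI ballI allI;
        simp only: component_add component_scale component_convolution component_mem i b)
qed

lemma balanced_expand:
  assumes \<theta>: "balanced (supported_on X) \<theta>" and x: "x \<in> supported_on X" and v: "v \<in> carrier V"
  shows "\<theta> x v = (\<Sum>i<n. \<theta> (component x i) v)"
proof -
  have "(\<Sum>i\<in>S. component x i) \<in> supported_on X \<and>
      \<theta> (\<Sum>i\<in>S. component x i) v = (\<Sum>i\<in>S. \<theta> (component x i) v)"
    if "finite S" "S \<subseteq> {..<n}" for S
    using that
  proof (induction S rule: finite_induct)
    case empty
    then show ?case
      using balanced_zero_left[OF g_submodule_supported_on \<theta> v] fs.subspace_0[OF subspace_supported_on]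
      by simp
  next
    case (insert i S)
    then have i: "component x i \<in> supported_on X"
      using component_mem[OF x, of i] W_subset[of i] by auto
    from insert have IH: "(\<Sum>i\<in>S. component x i) \<in> supported_on X"
      "\<theta> (\<Sum>i\<in>S. component x i) v = (\<Sum>i\<in>S. \<theta> (component x i) v)" by auto
    show ?case
      unfolding sum.insert[OF insert.hyps]
      using balanced_add_left[OF g_submodule_supported_on \<theta> i IH(1) v] IH(2)
        supported_on_closed(1)[OF i IH(1)] by (simp only: simp_thms)
  qed
  from this[of "{..<n}"] show ?thesis by (simp only: sum_component[OF x] finite_lessThan subset_refl simp_thms)
qed

text \<open>Balanced forms on \<open>M \<times> V\<close> are functionals on the tensor product. By Schur's lemma they are
  spanned by one form for each summand isomorphic to the dual of \<open>V\<close>; normalised at suitable pure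
  tensors, these forms become a dual basis.\<close>

lemma dim_tensor_product:
  defines "T \<equiv> tensor_product (single e) A M V"
  shows "vectorspace.fin_dim class_ring T \<and> vectorspace.dim class_ring T =
    card {i. i < n \<and> module_isomorphic A (M\<lparr>carrier := W i\<rparr>) DV}"
proof -
  define I where "I = {i. i < n \<and> module_isomorphic A (M\<lparr>carrier := W i\<rparr>) DV}"
  have I_n: "i < n" if "i \<in> I" for i using that by (simp add: I_def)
  define B where "B i = (SOME \<beta>. balanced (W i) \<beta> \<and> nonzero_form (W i) \<beta>)" for i
  have B: "balanced (W i) (B i)" "nonzero_form (W i) (B i)" if i: "i \<in> I" for i
  proof -
    have "\<exists>\<beta>. balanced (W i) \<beta> \<and> nonzero_form (W i) \<beta>"
      using nonzero_form_if_isomorphic[OF W_submodule W_simple, of i] i unfolding I_def by blast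
    from someI_ex[OF this] show "balanced (W i) (B i)" "nonzero_form (W i) (B i)"
      unfolding B_def by blast+
  qed
  \<comment> \<open>A nonzero value of \<open>B i\<close> is rescaled to 1; the resulting pairs
    provide the dual vectors.\<close>
  have "\<exists>z. fst z \<in> W i \<and> snd z \<in> carrier V \<and> B i (fst z) (snd z) = 1" if i: "i \<in> I" for i
  proof -
    obtain p v where pv: "p \<in> W i" "v \<in> carrier V" "B i p v \<noteq> 0"
      using B(2)[OF i] unfolding nonzero_form_def by blast
    have "B i (fscale (1 / B i p v) p) v = 1"
      using balanced_scale[OF W_submodule[OF I_n[OF i]] B(1)[OF i] pv(1,2)] pv(3) by simp
    moreover have "fscale (1 / B i p v) p \<in> W i"
      by (rule fs.subspace_scale[OF W_subspace[OF I_n[OF i]] pv(1)])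
    ultimately show ?thesis
      using pv(2) by (intro exI[of _ "(fscale (1 / B i p v) p, v)"]) simp
  qed
  then obtain z where z: "fst (z i) \<in> W i" "snd (z i) \<in> carrier V" "B i (fst (z i)) (snd (z i)) = 1"
    if "i \<in> I" for i
    by metis
  \<comment> \<open>The form \<open>B i\<close>, extended by zero on the other summands.\<close>
  define \<Phi> where "\<Phi> i x = B i (component x i)" for i x
  have \<Phi>: "balanced (supported_on X) (\<Phi> i)" if "i \<in> I" for i
    unfolding \<Phi>_def by (rule balanced_component[OF B(1)[OF that] I_n[OF that]])
  define L where "L i = free_extension (\<lambda>y. \<Phi> i (fst y) (snd y))" for i
  have "vectorspace.fin_dim class_ring (quotient_space F N) \<and>
    vectorspace.dim class_ring (quotient_space F N) = card I"
  proof (rule dim_quotient_dual_basis[OF free_space_vectorspace N_submodule])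
    show "finite I" by (simp add: I_def)
    fix i assume i: "i \<in> I"
    show "single (z i) 1 \<in> carrier F"
      using single_mem_F[of "fst (z i)" "snd (z i)"] z[OF i] W_subset[OF I_n[OF i]] by auto
    show "L i \<in> LinearCombinations.module_hom class_ring F field_module"
      unfolding L_def by (rule free_extension_hom)
  next
    fix i j assume i: "i \<in> I" and j: "j \<in> I"
    \<comment> \<open>The first entry of \<open>z j\<close> lies in \<open>W j\<close>, so its
      component at \<open>i\<close> is zero unless \<open>i = j\<close>.\<close>
    show "L i (single (z j) 1) = (if i = j then 1 else 0)"
      using z[OF i] z[OF j] component_of_summand[OF z(1)[OF j] I_n[OF j] I_n[OF i]]
        balanced_zero_left[OF W_submodule[OF I_n[OF i]] B(1)[OF i]]
      by (simp add: L_def free_extension_single \<Phi>_def)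
  next
    fix x assume x: "x \<in> carrier F"
    show "x \<in> N \<longleftrightarrow> (\<forall>i\<in>I. L i x = 0)"
    proof
      assume "x \<in> N"
      then show "\<forall>i\<in>I. L i x = 0"
        unfolding L_def using free_extension_balanced[OF \<Phi>] by blast
    next
      assume L: "\<forall>i\<in>I. L i x = 0"
      show "x \<in> N"
      proof (rule ccontr)
        assume "x \<notin> N"
        \<comment> \<open>A functional \<open>l\<close> vanishing on \<open>N\<close> but not at
          \<open>x\<close> gives a balanced form \<open>\<theta>\<close>. This turns out to be a
          combination of the \<open>\<Phi> i\<close>, so \<open>l x\<close> is a combination of the
          \<open>L i x\<close>, all of which vanish, against \<open>l x = 1\<close>.\<close>
        with N_subspace obtain l where l: "Vector_Spaces.linear fscale (*) l"
            "\<And>y. y \<in> N \<Longrightarrow> l y = 0" "l x = 1"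
          by (rule fs_separating_functional) blast
        define \<theta> where "\<theta> p v = l (single (p, v) 1)" for p v
        have \<theta>: "balanced (supported_on X) \<theta>"
          unfolding \<theta>_def by (rule balanced_of_functional[OF l(1,2)])
        \<comment> \<open>On summands isomorphic to the dual, Schur's lemma makes
          \<open>\<theta>\<close> a multiple of \<open>B i\<close>; on the others a nonzero form
          would produce an isomorphism.\<close>
        have "\<exists>c. \<forall>p\<in>W i. \<forall>v\<in>carrier V. \<theta> p v = (if i \<in> I then c * B i p v else 0)"
          if i: "i < n" for i
        proof (cases "i \<in> I")
          case True
          obtain c where "\<And>p v. p \<in> W i \<Longrightarrow> v \<in> carrier V \<Longrightarrow> \<theta> p v = c * B i p v"
            using balanced_proportional[OF W_submodule[OF i] W_simple[OF i] B[OF True]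
                balanced_subset[OF \<theta> W_subset[OF i]]] by blast
          with True show ?thesis by auto
        next
          case False
          then have "\<not> nonzero_form (W i) \<theta>"
            using isomorphic_if_nonzero_form[OF W_submodule[OF i]
                balanced_subset[OF \<theta> W_subset[OF i]] W_simple[OF i]] i
            unfolding I_def by blast
          with False show ?thesis by (auto simp: nonzero_form_def)
        qed
        then obtain c where c: "\<theta> p v = (if i \<in> I then c i * B i p v else 0)"
          if "i < n" "p \<in> W i" "v \<in> carrier V" for i p v
          by metis
        have expand: "\<theta> p v = (\<Sum>i\<in>I. c i * \<Phi> i p v)" if p: "p \<in> supported_on X" and v: "v \<in> carrier V" for p v
        proof -
          have "\<theta> p v = (\<Sum>i<n. if i \<in> I then c i * \<Phi> i p v else 0)"
            unfolding balanced_expand[OF \<theta> p v]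
            by (rule sum.cong) (use c component_mem[OF p] v in \<open>auto simp: \<Phi>_def\<close>)
          also have "\<dots> = (\<Sum>i\<in>I. c i * \<Phi> i p v)"
            by (rule sum.mono_neutral_cong_right) (auto simp: I_def)
          finally show ?thesis .
        qed
        have "l x = (\<Sum>y | x y \<noteq> 0. x y * (\<Sum>i\<in>I. c i * \<Phi> i (fst y) (snd y)))"
          unfolding functional_expand_F[OF l(1) x] free_extension_def \<theta>_def[symmetric]
          using x by (intro sum.cong) (auto simp: expand)
        also have "\<dots> = (\<Sum>i\<in>I. c i * L i x)"
          unfolding L_def free_extension_def sum_distrib_left
          by (subst sum.swap) (simp only: mult.left_commute)
        also have "\<dots> = 0" using L by simp
        finally show False using l(3) by simp
      qed
    qed
  qed
  then show ?thesis by (simp add: T_def tensor_product_def Let_def I_def)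
qed

end

end

text \<open>A group element \<open>g\<close> is \<open>tilde_L\<close>-related to \<open>e\<close>
  because \<open>g\<close> and \<open>e\<close> are left multiples of each other. Right congruence
  then relates \<open>a * g\<close> to \<open>e * g = g\<close>, hence to \<open>e\<close>.\<close>

lemma right_basis_tilde_L:
  fixes E :: "'a::{finite, semigroup_mult} set"
  assumes ehr: "ehresmann E" and e: "e \<in> E"
  shows "right_basis e {a. tilde_L E a e}"
proof
  show ee: "e * e = e" by (rule proj_idem[OF ehr e])
  show "a * e = a" if "a \<in> {a. tilde_L E a e}" for a
    using that e ee by (simp add: tilde_L_def)
  show "a * g \<in> {a. tilde_L E a e}" if a: "a \<in> {a. tilde_L E a e}" and g: "g \<in> green_H_class e" for a g
  proof -
    obtain h where h: "e * g = g" "g * e = g" "h * g = e"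
      using g green_H_class_iff[OF ee] by blast
    have "g * f = g \<longleftrightarrow> e * f = e" for f
      using h by (metis mult.assoc)
    then have "tilde_L E g e" by (simp add: tilde_L_def)
    moreover have "tilde_L E (a * g) g" using tilde_L_mult[OF ehr, of a e g] a h(1) by simp
    ultimately show ?thesis using tilde_L_trans by blast
  qed
qed

theorem corollary6p15:
  fixes E J :: "'a::{finite, semigroup_mult} set"
  assumes "EI_ehresmann E" and "right_restriction E"
    and "J \<in> UNIV // green_J" and "\<exists>a\<in>J. regular_element a"
    and "\<And>H :: 'a set. is_subgroup H \<Longrightarrow> (of_nat (card H) :: 'k::alg_closed_field) \<noteq> 0"
  shows "E \<inter> J \<noteq> {} \<and>
    (\<forall>e\<in>E \<inter> J. \<forall>V :: ('a \<Rightarrow> 'k, 'v) module.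
       left_module (group_algebra e) V \<and> simple_module (group_algebra e) V \<longrightarrow>
       (let T = tensor_product (single e) (group_algebra e) (tilde_L_module E e) V
        in vectorspace.fin_dim class_ring T \<and>
           has_multiplicity (group_algebra e) (tilde_L_module E e) (dual_module (single e) V)
             (vectorspace.dim class_ring T)))"
proof (intro conjI ballI allI impI)
  show "E \<inter> J \<noteq> {}" by (rule projection_in_regular_J_class[OF assms(1-4)])
  fix e and V :: "('a \<Rightarrow> 'k, 'v) module"
  assume e: "e \<in> E \<inter> J" and V: "left_module (group_algebra e) V \<and> simple_module (group_algebra e) V"
  let ?X = "{a. tilde_L E a e}"
  have ehr: "ehresmann E" using assms(1) by (simp add: EI_ehresmann_def)
  interpret right_basis e ?X
    by (rule right_basis_tilde_L[OF ehr]) (use e in simp)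
  interpret basis_simple_pair e ?X V
    by (intro basis_simple_pair.intro basis_simple_pair_axioms.intro right_basis_axioms conjunct1[OF V]
        conjunct2[OF V])
  \<comment> \<open>The group at \<open>e\<close> is itself one of the subgroups whose order is
    assumed invertible, so Maschke's theorem applies.\<close>
  have ex: "\<exists>n W. simple_decomposition A (basis_module ?X) n W"
    by (rule simple_decomposition_exists[OF assms(5)[OF is_subgroup_H]])
  let ?T = "tensor_product (single e) A (basis_module ?X) V"
  have dim: "vectorspace.fin_dim class_ring ?T \<and> vectorspace.dim class_ring ?T =
      card {i. i < n \<and> module_isomorphic A (basis_module ?X\<lparr>carrier := W i\<rparr>) DV}"
    if "simple_decomposition A (basis_module ?X) n W" for n W
    by (rule dim_tensor_product[OF that])
  have "has_multiplicity A (basis_module ?X) DV (vectorspace.dim class_ring ?T)"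
    unfolding has_multiplicity_def
    by (intro conjI allI impI ex) (rule dim[THEN conjunct2, symmetric])
  moreover have "vectorspace.fin_dim class_ring ?T"
    using ex by (elim exE) (rule dim[THEN conjunct1])
  ultimately show "let T = tensor_product (single e) A (tilde_L_module E e) V
      in vectorspace.fin_dim class_ring T \<and>
         has_multiplicity A (tilde_L_module E e) DV (vectorspace.dim class_ring T)"
    unfolding Let_def tilde_L_module_eq by (intro conjI)
qed

end
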